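(* Let $D_1,D_2\subset\mathbb{C}$ be domains. Then: (1) If at least one of $D_1$, $D_2$ is simply connected, then $h_{D_1\times D_2}\equiv\kappa_{D_1\times D_2}$. (2) If at least one of $D_1$, $D_2$ is biholomorphic to $\mathbb{C}_*:=\mathbb{C}\setminus\{0\}$, then $h_{D_1\times D_2}\equiv\kappa_{D_1\times D_2}$. (3) If neither $D_1$ nor $D_2$ is simply connected and neither is biholomorphic to $\mathbb{C}_*$, then $h_{D_1\times D_2}\not\equiv\kappa_{D_1\times D_2}$. In particular, $h_{D_1\times D_2}\equiv\kappa_{D_1\times D_2}$ if and only if at least one of $D_1,D_2$ is simply connected or biholomorphic to $\mathbb{C}_*$.
   Context: $E$ denotes the open unit disc in $\mathbb{C}$, and $\mathcal{O}(E,D)$ the set of holomorphic maps $E\to D$. For a domain $D\subset\mathbb{C}^n$, $z\in D$, $X\in\mathbb{C}^n$, the Kobayashi–Royden pseudometric is $\kappa_D(z;X):=\inf\{|\alpha| : \exists f\in\mathcal{O}(E,D),\ f(0)=z,\ \alpha f'(0)=X\}$ and the Hahn pseudometric is $h_D(z;X):=\inf\{|\alpha| : \exists f\in\mathcal{O}(E,D) \text{ injective},\ f(0)=z,\ \alpha f'(0)=X\}$. The notation $h_D\equiv\kappa_D$ means equality for all $(z,X)\in D\times\mathbb{C}^n$. *)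

theory Defs
  imports "HOL-Complex_Analysis.Complex_Analysis"
begin

definition domain_C :: "complex set \<Rightarrow> bool" where
  "domain_C D \<longleftrightarrow> open D \<and> connected D \<and> D \<noteq> {}"

definition biholomorphic :: "complex set \<Rightarrow> complex set \<Rightarrow> bool" where
  "biholomorphic S T \<longleftrightarrow> (\<exists>f g. f holomorphic_on S \<and> g holomorphic_on T \<and>
      (\<forall>z\<in>S. f z \<in> T \<and> g (f z) = z) \<and> (\<forall>w\<in>T. g w \<in> S \<and> f (g w) = w))"

definition hol_discs :: "(complex \<times> complex) set \<Rightarrow> (complex \<Rightarrow> complex \<times> complex) set" where
  "hol_discs D = {f. (\<lambda>z. fst (f z)) holomorphic_on ball 0 1 \<and>
                     (\<lambda>z. snd (f z)) holomorphic_on ball 0 1 \<and> f ` ball 0 1 \<subseteq> D}"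

definition disc_deriv0 :: "(complex \<Rightarrow> complex \<times> complex) \<Rightarrow> complex \<times> complex" where
  "disc_deriv0 f = (deriv (\<lambda>z. fst (f z)) 0, deriv (\<lambda>z. snd (f z)) 0)"

definition kobayashi :: "(complex \<times> complex) set \<Rightarrow> complex \<times> complex \<Rightarrow> complex \<times> complex \<Rightarrow> real" where
  "kobayashi D z X = Inf {cmod \<alpha> | \<alpha> f. f \<in> hol_discs D \<and> f 0 = z \<and>
      (\<alpha> * fst (disc_deriv0 f), \<alpha> * snd (disc_deriv0 f)) = X}"

definition hahn :: "(complex \<times> complex) set \<Rightarrow> complex \<times> complex \<Rightarrow> complex \<times> complex \<Rightarrow> real" where
  "hahn D z X = Inf {cmod \<alpha> | \<alpha> f. f \<in> hol_discs D \<and> inj_on f (ball 0 1) \<and> f 0 = z \<and>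
      (\<alpha> * fst (disc_deriv0 f), \<alpha> * snd (disc_deriv0 f)) = X}"

definition hahn_eq_kobayashi :: "(complex \<times> complex) set \<Rightarrow> bool" where
  "hahn_eq_kobayashi D \<longleftrightarrow> (\<forall>z\<in>D. \<forall>X. hahn D z X = kobayashi D z X)"

end

theory Submission
  imports Defs
begin

text \<open>
  For the positive cases one perturbs a disc \<open>(f\<^sub>1, f\<^sub>2)\<close> to an injective one with almost the same
  derivative. If \<open>f\<^sub>2\<close> omits a value \<open>w\<close>, then \<open>t (f\<^sub>2 t - w)\<close> plus a multiple of \<open>f\<^sub>2\<close> separates the points
  identified by \<open>f\<^sub>2\<close>; a small multiple of it, or its exponential when the first factor is the
  punctured plane, replaces \<open>f\<^sub>1\<close>.

  For the negative case both factors omit two points and hence have holomorphic universal coverings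
  by the disc, which are the extremal discs for the Kobayashi metric. Neither is injective. Moving base
  points, one arranges that nontrivial deck transformations \<open>\<psi>\<^sub>1\<close>, \<open>\<psi>\<^sub>2\<close> of the two coverings agree
  at \<open>0\<close> but have different derivatives there. The pair of coverings then has a transversal double
  point, which persists in every disc that is almost extremal in the direction of their derivatives,
  so no such disc is injective.
\<close>

section \<open>Injective approximation of discs in products\<close>

text \<open>Both metrics are infima, so the positive half may lose a factor
  \<open>\<theta> < 1\<close>; that loss makes the shrunken discs bounded. The negative half cannot
  argue with an extremal injective disc: the infimum need not be attained, and a limit of injective
  discs need not be injective. Injectivity has to be refuted for every disc near the extremal one.
  The chosen direction is extremal in both factors at once. Each component of an almost extremal
  disc therefore lifts, after one common rotation of the parameter, to a self-map of the unit disc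
  fixing 0 with derivative almost 1, and the Schwarz lemma keeps both lifts close to the identity on
  compact sets. A mere coincidence of the two deck transformations at 0 might be lost under such a
  perturbation; different derivatives there make it a nondegenerate zero, which cannot disappear.
  The coverings enter only through the lifting of discs, and this is why they are built from that
  property.\<close>

definition disc_map :: "complex set \<Rightarrow> (complex \<Rightarrow> complex) \<Rightarrow> bool" where
  "disc_map D f \<longleftrightarrow> f holomorphic_on ball 0 1 \<and> f ` ball 0 1 \<subseteq> D"

lemma disc_mapI:
  "f holomorphic_on ball 0 1 \<Longrightarrow> (\<And>t. norm t < 1 \<Longrightarrow> f t \<in> D) \<Longrightarrow> disc_map D f"
  by (auto simp: disc_map_def)

lemma disc_map_holomorphic: "disc_map D f \<Longrightarrow> f holomorphic_on ball 0 1"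
  by (simp add: disc_map_def)

lemma disc_map_mem: "disc_map D f \<Longrightarrow> norm t < 1 \<Longrightarrow> f t \<in> D"
  by (auto simp: disc_map_def)

lemma disc_map_mono: "disc_map S f \<Longrightarrow> S \<subseteq> T \<Longrightarrow> disc_map T f"
  by (auto simp: disc_map_def)

lemma disc_map_has_derivative:
  "disc_map D f \<Longrightarrow> (f has_field_derivative deriv f 0) (at 0)"
  by (auto simp: disc_map_def intro: holomorphic_derivI)

lemma disc_map_compose:
  assumes "disc_map S f" "h holomorphic_on S" "h ` S \<subseteq> T"
  shows "disc_map T (\<lambda>t. h (f t))"
  using assms holomorphic_on_compose_gen[of f "ball 0 1" h S]
  by (auto simp: disc_map_def o_def)

lemma disc_map_scale:
  assumes "disc_map D f" "norm c \<le> 1"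
  shows "disc_map D (\<lambda>t. f (c * t))"
proof -
  have "norm (c * t) < 1" if "norm t < 1" for t
    using that assms(2) mult_left_le_one_le[of "norm t" "norm c"] by (simp add: norm_mult)
  then have "disc_map (ball 0 1) (\<lambda>t. c * t)"
    by (auto intro!: disc_mapI holomorphic_intros)
  then show ?thesis
    by (rule disc_map_compose) (use assms(1) in \<open>auto simp: disc_map_def\<close>)
qed

lemma deriv_scale:
  assumes "disc_map D f"
  shows "((\<lambda>t. f (c * t)) has_field_derivative c * deriv f 0) (at 0)"
proof -
  have "((\<lambda>t. f (c * t)) has_field_derivative deriv f 0 * c) (at 0)"
  proof (rule DERIV_chain2[of f])
    show "((*) c has_field_derivative c) (at 0)" by (auto intro!: derivative_eq_intros)
  qed (use disc_map_has_derivative[OF assms] in simp)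
  then show ?thesis by (simp add: mult.commute)
qed

lemma disc_map_scale_bounded:
  fixes c :: complex
  assumes "disc_map D f" "norm c < 1"
  obtains K where "0 < K" "\<And>t::complex. norm t < 1 \<Longrightarrow> norm (f (c * t)) \<le> K"
proof -
  have "compact (f ` cball 0 (norm c))"
  proof (rule compact_continuous_image)
    show "continuous_on (cball 0 (norm c)) f"
      by (rule continuous_on_subset[of "ball 0 1"])
        (use assms in \<open>auto simp: disc_map_def holomorphic_on_imp_continuous_on\<close>)
  qed simp
  then have "bounded (f ` cball 0 (norm c))" by (rule compact_imp_bounded)
  then obtain K where K: "0 < K" "\<And>w. w \<in> f ` cball 0 (norm c) \<Longrightarrow> norm w \<le> K"
    unfolding bounded_pos by auto
  have mem: "c * t \<in> cball 0 (norm c)" if "norm t < 1" for t :: complex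
    unfolding mem_cball_0 norm_mult by (rule mult_left_le) (use that in auto)
  show thesis
  proof (rule that[OF K(1)])
    fix t :: complex assume "norm t < 1"
    then have "f (c * t) \<in> f ` cball 0 (norm c)" using mem[of t] by blast
    then show "norm (f (c * t)) \<le> K" by (rule K(2))
  qed
qed

section \<open>Injective discs with the same centre and almost the same derivative\<close>

definition inj_match ::
  "complex set \<Rightarrow> complex set \<Rightarrow> (complex \<Rightarrow> complex) \<Rightarrow> (complex \<Rightarrow> complex) \<Rightarrow> real \<Rightarrow> bool" where
  "inj_match D1 D2 f1 f2 \<theta> \<longleftrightarrow> (\<exists>g1 g2. disc_map D1 g1 \<and> disc_map D2 g2 \<and> g1 0 = f1 0 \<and> g2 0 = f2 0 \<and>
     deriv g1 0 = \<theta> * deriv f1 0 \<and> deriv g2 0 = \<theta> * deriv f2 0 \<and>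
     (\<forall>s t. norm s < 1 \<longrightarrow> norm t < 1 \<longrightarrow> g1 s = g1 t \<longrightarrow> g2 s = g2 t \<longrightarrow> s = t))"

lemma inj_matchI:
  assumes "disc_map D1 g1" "disc_map D2 g2" "g1 0 = f1 0" "g2 0 = f2 0"
    and "(g1 has_field_derivative \<theta> * deriv f1 0) (at 0)"
    and "(g2 has_field_derivative \<theta> * deriv f2 0) (at 0)"
    and "\<And>s t. norm s < 1 \<Longrightarrow> norm t < 1 \<Longrightarrow> g1 s = g1 t \<Longrightarrow> g2 s = g2 t \<Longrightarrow> s = t"
  shows "inj_match D1 D2 f1 f2 \<theta>"
  unfolding inj_match_def
proof (intro exI conjI allI impI)
  show "deriv g1 0 = \<theta> * deriv f1 0" by (rule DERIV_imp_deriv[OF assms(5)])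
  show "deriv g2 0 = \<theta> * deriv f2 0" by (rule DERIV_imp_deriv[OF assms(6)])
  show "s = t" if "norm s < 1" "norm t < 1" "g1 s = g1 t" "g2 s = g2 t" for s t
    by (rule assms(7)[OF that])
qed (rule assms)+

lemma inj_match_swap: "inj_match D1 D2 f1 f2 \<theta> \<Longrightarrow> inj_match D2 D1 f2 f1 \<theta>"
  unfolding inj_match_def by blast

text \<open>The base point in the first factor is a parameter because discs in the unit disc are
  treated at 0 and carried elsewhere by biholomorphisms. Vanishing derivatives are left to
  \<open>inj_match_degenerate\<close>.\<close>

definition inj_dense_at :: "complex set \<Rightarrow> complex set \<Rightarrow> complex \<Rightarrow> bool" where
  "inj_dense_at D1 D2 z1 \<longleftrightarrow> (\<forall>f1 f2 \<theta>. disc_map D1 f1 \<longrightarrow> disc_map D2 f2 \<longrightarrow> f1 0 = z1 \<longrightarrow>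
     deriv f1 0 \<noteq> 0 \<longrightarrow> deriv f2 0 \<noteq> 0 \<longrightarrow> 0 < \<theta> \<longrightarrow> \<theta> < 1 \<longrightarrow> inj_match D1 D2 f1 f2 \<theta>)"

text \<open>The function is \<open>t \<mapsto> k t (f t - w) + l (f t - f 0)\<close>, where \<open>l\<close> is free to adjust the derivative
  at the origin.\<close>

lemma separating_function:
  assumes f: "disc_map D f" and w: "w \<notin> D" and nz: "deriv f 0 \<noteq> 0"
  obtains h where "h holomorphic_on ball 0 1" "h 0 = 0" "(h has_field_derivative b) (at 0)"
    "\<And>s t. norm s < 1 \<Longrightarrow> norm t < 1 \<Longrightarrow> f s = f t \<Longrightarrow> h s - h t = k * (s - t) * (f s - w)"
    "\<And>K. (\<And>t. norm t < 1 \<Longrightarrow> norm (f t) \<le> K) \<Longrightarrow> \<exists>L>0. \<forall>t. norm t < 1 \<longrightarrow> norm (h t) \<le> L"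
proof -
  define l where "l = (b - k * (f 0 - w)) / deriv f 0"
  define h where "h t = k * t * (f t - w) + l * (f t - f 0)" for t
  note d = disc_map_has_derivative[OF f]
  show thesis
  proof
    show "h holomorphic_on ball 0 1"
      unfolding h_def by (intro holomorphic_intros disc_map_holomorphic[OF f])
    show "h 0 = 0" by (simp add: h_def)
    show "(h has_field_derivative b) (at 0)"
      unfolding h_def by (rule derivative_eq_intros d refl)+ (use nz in \<open>simp add: l_def\<close>)
    show "h s - h t = k * (s - t) * (f s - w)" if "f s = f t" for s t
      using that by (simp add: h_def algebra_simps)
    show "\<exists>L>0. \<forall>t. norm t < 1 \<longrightarrow> norm (h t) \<le> L"
      if K: "\<And>t. norm t < 1 \<Longrightarrow> norm (f t) \<le> K" for K
    proof (intro exI conjI allI impI)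
      have K0: "0 \<le> K" using K[of 0] norm_ge_zero[of "f 0"] by (simp del: norm_ge_zero)
      show "0 < norm k * (K + norm w) + norm l * (K + K) + 1"
        using K0 by (simp add: add_nonneg_pos)
      fix t :: complex assume t: "norm t < 1"
      have 1: "norm (f t - w) \<le> K + norm w" using norm_triangle_ineq4[of "f t" w] K[OF t] by linarith
      have "norm (k * t * (f t - w)) \<le> norm k * 1 * (K + norm w)"
        unfolding norm_mult using t 1 K0 by (intro mult_mono) auto
      moreover have "norm (f t - f 0) \<le> K + K"
        using norm_triangle_ineq4[of "f t" "f 0"] K[OF t] K[of 0] by simp
      then have "norm (l * (f t - f 0)) \<le> norm l * (K + K)"
        unfolding norm_mult by (intro mult_left_mono) auto
      ultimately show "norm (h t) \<le> norm k * (K + norm w) + norm l * (K + K) + 1"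
        unfolding h_def using norm_triangle_ineq[of "k * t * (f t - w)" "l * (f t - f 0)"] by linarith
    qed
  qed
qed

lemma disc_map_affine: "disc_map UNIV (\<lambda>t. z + c * t)"
  by (auto intro!: disc_mapI holomorphic_intros)

text \<open>The plane contains affine discs of every derivative, and such a disc is injective by
  itself, so the second component only has to be shrunk.\<close>

lemma inj_match_UNIV:
  assumes f1: "disc_map UNIV f1" and f2: "disc_map D2 f2" and nz: "deriv f1 0 \<noteq> 0" and \<theta>: "0 < \<theta>" "\<theta> < 1"
  shows "inj_match UNIV D2 f1 f2 \<theta>"
proof (rule inj_matchI)
  show "disc_map UNIV (\<lambda>t. f1 0 + \<theta> * deriv f1 0 * t)" by (rule disc_map_affine)
  show "((\<lambda>t. f1 0 + \<theta> * deriv f1 0 * t) has_field_derivative \<theta> * deriv f1 0) (at 0)"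
    by (auto intro!: derivative_eq_intros)
  show "disc_map D2 (\<lambda>t. f2 (\<theta> * t))" using \<theta> by (intro disc_map_scale[OF f2]) auto
  show "((\<lambda>t. f2 (\<theta> * t)) has_field_derivative \<theta> * deriv f2 0) (at 0)"
    by (rule deriv_scale[OF f2])
qed (use nz \<theta> in auto)

text \<open>With derivative 0 the first component may be replaced by a constant plus a small
  separating function of derivative 0. Openness of \<open>D1\<close> leaves room for it.\<close>

lemma inj_match_degenerate:
  assumes f1: "disc_map D1 f1" and f2: "disc_map D2 f2" and "open D1"
    and z: "deriv f1 0 = 0" and nz: "deriv f2 0 \<noteq> 0" and \<theta>: "0 < \<theta>" "\<theta> < 1"
  shows "inj_match D1 D2 f1 f2 \<theta>"
proof (cases "D2 = UNIV")
  case True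
  then show ?thesis using inj_match_UNIV[of f2 D1 f1 \<theta>] assms inj_match_swap by blast
next
  case False
  then obtain w where w: "w \<notin> D2" by blast
  define g where "g t = f2 (\<theta> * t)" for t :: complex
  have g: "disc_map D2 g" using \<theta> unfolding g_def by (intro disc_map_scale[OF f2]) auto
  have dg: "(g has_field_derivative \<theta> * deriv f2 0) (at 0)"
    unfolding g_def by (rule deriv_scale[OF f2])
  then have dg': "deriv g 0 \<noteq> 0" using nz \<theta> DERIV_imp_deriv by fastforce
  \<comment> \<open>The values of \<open>g\<close> are those of \<open>f2\<close> on a compact
    smaller disc; \<open>f2\<close> itself may be unbounded.\<close>
  obtain K where K: "\<And>t. norm t < 1 \<Longrightarrow> norm (g t) \<le> K"
    using disc_map_scale_bounded[OF f2, of "of_real \<theta>"] \<theta> unfolding g_def by (auto simp: norm_mult)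
  obtain h where h: "h holomorphic_on ball 0 1" "h 0 = 0" "(h has_field_derivative 0) (at 0)"
    and sep: "\<And>s t. norm s < 1 \<Longrightarrow> norm t < 1 \<Longrightarrow> g s = g t \<Longrightarrow> h s - h t = 1 * (s - t) * (g s - w)"
    and bd: "\<exists>L>0. \<forall>t. norm t < 1 \<longrightarrow> norm (h t) \<le> L"
    using separating_function[OF g w dg', of 0 1] K by metis
  obtain L where L: "0 < L" "\<And>t. norm t < 1 \<Longrightarrow> norm (h t) \<le> L" using bd by blast
  obtain e where e: "0 < e" "cball (f1 0) e \<subseteq> D1"
    using \<open>open D1\<close> disc_map_mem[OF f1, of 0] by (auto simp: open_contains_cball)
  define c where "c = e / L"
  have c: "0 < c" using e L by (simp add: c_def)
  have *: "norm (c * h t) \<le> e" if "norm t < 1" for t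
    using L(2)[OF that] L(1) c e by (simp add: norm_mult norm_divide c_def field_simps)
  show ?thesis
  proof (rule inj_matchI[OF _ g])
    show "disc_map D1 (\<lambda>t. f1 0 + c * h t)"
      using e(2) * by (intro disc_mapI holomorphic_intros h) (auto simp: subset_iff dist_norm)
    show "((\<lambda>t. f1 0 + c * h t) has_field_derivative \<theta> * deriv f1 0) (at 0)"
      by (rule derivative_eq_intros h refl)+ (simp add: z)
    show "s = t" if "norm s < 1" "norm t < 1" "f1 0 + c * h s = f1 0 + c * h t" "g s = g t" for s t
      using sep[OF that(1,2,4)] that(3) c disc_map_mem[OF g that(1)] w by auto
  qed (use h dg g_def in auto)
qed

lemma inj_dense_at_UNIV: "inj_dense_at UNIV D2 z1"
  unfolding inj_dense_at_def using inj_match_UNIV by blast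

text \<open>By the Schwarz lemma the derivative has norm at most 1, so the linear map with the
  required derivative stays in the disc and is injective by itself.\<close>

lemma inj_dense_at_disc: "inj_dense_at (ball 0 1) D2 0"
  unfolding inj_dense_at_def
proof (intro allI impI)
  fix f1 f2 \<theta> assume f1: "disc_map (ball 0 1) f1" and f2: "disc_map D2 f2" and 0: "f1 0 = 0"
    and nz: "deriv f1 0 \<noteq> 0" and \<theta>: "0 < \<theta>" "\<theta> < (1::real)"
  have "norm (deriv f1 0) \<le> 1"
    using Schwarz_Lemma(2)[of f1 0] disc_map_mem[OF f1] disc_map_holomorphic[OF f1] 0 by simp
  then have le: "norm (\<theta> * deriv f1 0) \<le> 1"
    using \<theta> by (simp add: norm_mult mult_le_one)
  show "inj_match (ball 0 1) D2 f1 f2 \<theta>"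
  proof (rule inj_matchI)
    have "disc_map (ball 0 1) (\<lambda>t::complex. t)" by (auto intro!: disc_mapI)
    then show "disc_map (ball 0 1) (\<lambda>t. \<theta> * deriv f1 0 * t)"
      using disc_map_scale[OF _ le] by blast
    show "((\<lambda>t. \<theta> * deriv f1 0 * t) has_field_derivative \<theta> * deriv f1 0) (at 0)"
      by (auto intro!: derivative_eq_intros)
    show "disc_map D2 (\<lambda>t. f2 (\<theta> * t))" using \<theta> by (intro disc_map_scale[OF f2]) auto
    show "((\<lambda>t. f2 (\<theta> * t)) has_field_derivative \<theta> * deriv f2 0) (at 0)"
      by (rule deriv_scale[OF f2])
  qed (use nz \<theta> 0 in auto)
qed

lemma inj_dense_at_punctured_plane: "inj_dense_at (- {0}) D2 z1"
  unfolding inj_dense_at_def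
proof (intro allI impI)
  fix f1 f2 \<theta> assume f1: "disc_map (- {0}) f1" and f2: "disc_map D2 f2" and 0: "f1 0 = z1"
    and nz: "deriv f1 0 \<noteq> 0" "deriv f2 0 \<noteq> 0" and \<theta>: "0 < \<theta>" "\<theta> < (1::real)"
  show "inj_match (- {0}) D2 f1 f2 \<theta>"
  proof (cases "D2 = UNIV")
    case True
    then show ?thesis using inj_match_UNIV[of f2 "- {0}" f1 \<theta>] f1 f2 nz \<theta> inj_match_swap by blast
  next
    case False
    then obtain w where w: "w \<notin> D2" by blast
    define g where "g t = f2 (\<theta> * t)" for t :: complex
    have g: "disc_map D2 g" using \<theta> unfolding g_def by (intro disc_map_scale[OF f2]) auto
    have dg: "(g has_field_derivative \<theta> * deriv f2 0) (at 0)"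
      unfolding g_def by (rule deriv_scale[OF f2])
    then have dg': "deriv g 0 \<noteq> 0" using nz \<theta> DERIV_imp_deriv by fastforce
    obtain K where K: "0 < K" "\<And>t. norm t < 1 \<Longrightarrow> norm (g t) \<le> K"
      using disc_map_scale_bounded[OF f2, of "of_real \<theta>"] \<theta> unfolding g_def by (auto simp: norm_mult)
    \<comment> \<open>At a double point of \<open>g\<close> the difference of \<open>h\<close> is
      \<open>k * (s - t) * (g s - w)\<close>, where \<open>s - t\<close> has norm at most 2. This
      \<open>k\<close> bounds it by 2, which is less than the period of \<open>exp\<close>, so
      \<open>exp\<close> keeps such points apart.\<close>
    define k where "k = 1 / (K + norm w)"
    have k: "0 < k" using K by (auto simp: k_def add_pos_nonneg)
    have z1: "z1 \<noteq> 0" using disc_map_mem[OF f1, of 0] 0 by auto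
    obtain h where h: "h holomorphic_on ball 0 1" "h 0 = 0"
        "(h has_field_derivative \<theta> * deriv f1 0 / z1) (at 0)"
      and sep: "\<And>s t::complex. norm s < 1 \<Longrightarrow> norm t < 1 \<Longrightarrow> g s = g t \<Longrightarrow> h s - h t = k * (s - t) * (g s - w)"
      by (rule separating_function[OF g w dg', of "\<theta> * deriv f1 0 / z1" "of_real k"]) blast
    show ?thesis
    proof (rule inj_matchI[OF _ g])
      show "disc_map (- {0}) (\<lambda>t. z1 * exp (h t))"
        using z1 by (intro disc_mapI holomorphic_intros h) auto
      show "((\<lambda>t. z1 * exp (h t)) has_field_derivative \<theta> * deriv f1 0) (at 0)"
        by (rule derivative_eq_intros h refl)+ (use z1 h(2) in simp)
      show "s = t" if st: "norm s < 1" "norm t < 1" "z1 * exp (h s) = z1 * exp (h t)" "g s = g t" for s t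
      proof -
        have "norm (g s - w) \<le> K + norm w"
          using norm_triangle_ineq4[of "g s" w] K(2)[OF st(1)] by linarith
        moreover have "norm (s - t) \<le> 2" using norm_triangle_ineq4[of s t] st by linarith
        ultimately have "norm (h s - h t) \<le> k * 2 * (K + norm w)"
          unfolding sep[OF st(1,2,4)] norm_mult using k by (intro mult_mono) auto
        also have "\<dots> = 2" using k unfolding k_def by (auto simp: divide_simps)
        finally have n2: "norm (h s - h t) \<le> 2" .
        have "exp (h s) = exp (h t)" using st z1 by simp
        moreover have "\<bar>Im (h s) - Im (h t)\<bar> < 2 * pi"
          using n2 abs_Im_le_cmod[of "h s - h t"] pi_gt3 by simp
        ultimately have "h s = h t" by (rule exp_complex_eqI[rotated])
        then show "s = t" using sep[OF st(1,2,4)] k disc_map_mem[OF g st(1)] w by auto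
      qed
    qed (use h dg g_def 0 in auto)
  qed
qed

text \<open>The derivatives of \<open>u\<close> and \<open>v\<close> at corresponding points are
  reciprocal, so transporting the disc to \<open>S\<close> and back leaves the factor
  \<open>\<theta>\<close> unchanged.\<close>

lemma inj_dense_at_biholomorphic:
  assumes u: "u holomorphic_on D1" and v: "v holomorphic_on S"
    and uv: "\<forall>z\<in>D1. u z \<in> S \<and> v (u z) = z" and vu: "\<forall>w\<in>S. v w \<in> D1 \<and> u (v w) = w"
    and "open D1" "open S" "inj_dense_at S D2 (u z1)"
  shows "inj_dense_at D1 D2 z1"
  unfolding inj_dense_at_def
proof (intro allI impI)
  fix f1 f2 \<theta> assume f1: "disc_map D1 f1" and f2: "disc_map D2 f2" and 0: "f1 0 = z1"
    and nz: "deriv f1 0 \<noteq> 0" "deriv f2 0 \<noteq> 0" and \<theta>: "0 < \<theta>" "\<theta> < (1::real)"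
  have z1: "z1 \<in> D1" using disc_map_mem[OF f1, of 0] 0 by simp
  have du: "(u has_field_derivative deriv u z1) (at z1)"
    using holomorphic_derivI[OF u \<open>open D1\<close> z1] .
  have dv: "(v has_field_derivative deriv v (u z1)) (at (u z1))"
    using holomorphic_derivI[OF v \<open>open S\<close>] uv z1 by blast
  have "((\<lambda>z. v (u z)) has_field_derivative deriv v (u z1) * deriv u z1) (at z1)"
    using DERIV_chain2[OF dv du] .
  moreover have "((\<lambda>z. v (u z)) has_field_derivative 1) (at z1)"
    by (rule has_field_derivative_transform_within_open[OF _ \<open>open D1\<close> z1, of "\<lambda>z. z"])
      (use uv in auto)
  ultimately have vu1: "deriv v (u z1) * deriv u z1 = 1" using DERIV_unique by blast
  have uf: "disc_map S (\<lambda>t. u (f1 t))" using disc_map_compose[OF f1 u] uv by blast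
  have duf: "deriv (\<lambda>t. u (f1 t)) 0 = deriv u z1 * deriv f1 0"
    using DERIV_chain2[of u "deriv u z1" f1 0] du disc_map_has_derivative[OF f1] 0
    by (auto intro: DERIV_imp_deriv)
  have "deriv u z1 * deriv f1 0 \<noteq> 0" using vu1 nz by auto
  then have "inj_match S D2 (\<lambda>t. u (f1 t)) f2 \<theta>"
    using assms(7) uf f2 0 nz \<theta> duf unfolding inj_dense_at_def by metis
  then obtain g1 g2 where g: "disc_map S g1" "disc_map D2 g2" "g1 0 = u (f1 0)" "g2 0 = f2 0"
    "deriv g1 0 = \<theta> * (deriv u z1 * deriv f1 0)" "deriv g2 0 = \<theta> * deriv f2 0"
    "\<forall>s t. norm s < 1 \<longrightarrow> norm t < 1 \<longrightarrow> g1 s = g1 t \<longrightarrow> g2 s = g2 t \<longrightarrow> s = t"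
    unfolding inj_match_def duf by blast
  show "inj_match D1 D2 f1 f2 \<theta>"
  proof (rule inj_matchI[of _ "\<lambda>t. v (g1 t)" _ g2])
    show "disc_map D1 (\<lambda>t. v (g1 t))" using disc_map_compose[OF g(1) v] vu by blast
    have "((\<lambda>t. v (g1 t)) has_field_derivative deriv v (u z1) * deriv g1 0) (at 0)"
      using DERIV_chain2[of v _ g1 0] dv disc_map_has_derivative[OF g(1)] g(3) 0 by auto
    moreover have "deriv v (u z1) * deriv g1 0 = (deriv v (u z1) * deriv u z1) * (\<theta> * deriv f1 0)"
      by (simp add: g(5))
    ultimately show "((\<lambda>t. v (g1 t)) has_field_derivative \<theta> * deriv f1 0) (at 0)"
      by (simp add: vu1)
    show "v (g1 0) = f1 0" using g(3) uv 0 z1 by auto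
    show "(g2 has_field_derivative \<theta> * deriv f2 0) (at 0)"
      using disc_map_has_derivative[OF g(2)] g(6) by simp
    show "s = t" if "norm s < 1" "norm t < 1" "v (g1 s) = v (g1 t)" "g2 s = g2 t" for s t
      using that g(7) vu disc_map_mem[OF g(1)] by metis
  qed (use g in auto)
qed

text \<open>The Riemann map, followed by a disc automorphism that moves the image of
  \<open>z1\<close> to 0, reduces this to \<open>inj_dense_at_disc\<close>; the whole plane is
  separate.\<close>

lemma inj_dense_at_simply_connected:
  assumes "domain_C D1" "simply_connected D1" "z1 \<in> D1"
  shows "inj_dense_at D1 D2 z1"
proof (cases "D1 = UNIV")
  case True
  then show ?thesis using inj_dense_at_UNIV by simp
next
  case False
  have "open D1" using assms by (simp add: domain_C_def)
  obtain u v where u: "u holomorphic_on D1" and v: "v holomorphic_on ball 0 1"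
    and uv: "\<forall>z\<in>D1. u z \<in> ball 0 1 \<and> v (u z) = z" and vu: "\<forall>w\<in>ball 0 1. v w \<in> D1 \<and> u (v w) = w"
    using simply_connected_eq_biholomorphic_to_disc[OF \<open>open D1\<close>] assms False
    by (auto simp: domain_C_def)
  obtain p q where p: "p (u z1) = 0" "p holomorphic_on ball 0 1" "p ` ball 0 1 \<subseteq> ball 0 1"
    "q holomorphic_on ball 0 1" "q ` ball 0 1 \<subseteq> ball 0 1"
    "\<And>z. z \<in> ball 0 1 \<Longrightarrow> p (q z) = z" "\<And>z. z \<in> ball 0 1 \<Longrightarrow> q (p z) = z"
    using ball_biholomorphism_exists[of "u z1"] uv assms by blast
  show ?thesis
  proof (rule inj_dense_at_biholomorphic[of "\<lambda>z. p (u z)" _ "\<lambda>w. v (q w)" "ball 0 1"])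
    show "(\<lambda>z. p (u z)) holomorphic_on D1"
      using holomorphic_on_compose_gen[OF u p(2)] uv by (simp add: o_def image_subset_iff)
    show "(\<lambda>z. v (q z)) holomorphic_on ball 0 1"
      using holomorphic_on_compose_gen[OF p(4) v p(5)] by (simp add: o_def)
    show "inj_dense_at (ball 0 1) D2 (p (u z1))" using p(1) inj_dense_at_disc by simp
    show "\<forall>z\<in>D1. p (u z) \<in> ball 0 1 \<and> v (q (p (u z))) = z" using uv p by (metis image_subset_iff)
    show "\<forall>w\<in>ball 0 1. v (q w) \<in> D1 \<and> p (u (v (q w))) = w" using vu p by (metis image_subset_iff)
  qed (use \<open>open D1\<close> in auto)
qed

section \<open>From injective discs to the two metrics\<close>

lemma bdd_below_cmod: "bdd_below {cmod \<alpha> | \<alpha> f. P \<alpha> f}"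
  by (intro bdd_belowI[of _ 0]) auto

text \<open>The infima carry information only over nonempty sets; a small affine disc is a
  competitor for both. The last conjunct makes the Hahn metric vanish at
  \<open>X = 0\<close>.\<close>

lemma hahn_set_nonempty:
  assumes "open D" "z \<in> D"
  shows "\<exists>\<alpha> f. f \<in> hol_discs D \<and> inj_on f (ball 0 1) \<and> f 0 = z \<and>
      (\<alpha> * fst (disc_deriv0 f), \<alpha> * snd (disc_deriv0 f)) = X \<and> (X = 0 \<longrightarrow> \<alpha> = 0)"
proof -
  obtain e where e: "0 < e" "ball z e \<subseteq> D" using assms open_contains_ball by blast
  \<comment> \<open>For \<open>X = 0\<close> any nonzero direction keeps the disc injective; the
    multiplier \<open>\<alpha> = 0\<close> then yields \<open>X\<close>.\<close>
  define Y where "Y = (if X = 0 then (1,1) else X)"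
  have Y: "Y \<noteq> 0" by (auto simp: Y_def zero_prod_def)
  define r where "r = e / norm Y"
  have r: "0 < r" using e Y by (simp add: r_def)
  define f where "f t = (fst z + r * fst Y * t, snd z + r * snd Y * t)" for t :: complex
  have d: "disc_deriv0 f = (r * fst Y, r * snd Y)"
    unfolding disc_deriv0_def f_def by (auto intro!: DERIV_imp_deriv derivative_eq_intros)
  have "f t \<in> D" if "norm t < 1" for t
  proof -
    have 1: "norm (fst Y * t, snd Y * t) = norm Y * norm t"
      by (simp add: norm_prod_def norm_mult power_mult_distrib real_sqrt_mult flip: distrib_right)
    have "f t - z = r *\<^sub>R (fst Y * t, snd Y * t)"
      by (simp add: f_def prod_eq_iff scaleR_conv_of_real)
    then have "norm (f t - z) = r * (norm Y * norm t)" using r 1 by (simp del: scaleR_Pair)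
    also have "\<dots> < e" using that e Y by (simp add: r_def)
    finally show ?thesis using e(2) by (metis dist_commute dist_norm mem_ball subsetD)
  qed
  then have "f \<in> hol_discs D"
    unfolding hol_discs_def by (auto simp: f_def intro!: holomorphic_intros)
  moreover have "inj_on f (ball 0 1)"
    using Y r by (auto simp: inj_on_def f_def prod_eq_iff)
  moreover have "f 0 = z" by (simp add: f_def)
  moreover define \<alpha> where "\<alpha> = (if X = 0 then 0 else 1 / complex_of_real r)"
  have "(\<alpha> * fst (disc_deriv0 f), \<alpha> * snd (disc_deriv0 f)) = X"
    using r by (auto simp: d Y_def \<alpha>_def prod_eq_iff)
  moreover have "X = 0 \<longrightarrow> \<alpha> = 0" by (simp add: \<alpha>_def)
  ultimately show ?thesis by blast
qed

lemma kobayashi_le_hahn: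
  assumes "open D" "z \<in> D"
  shows "kobayashi D z X \<le> hahn D z X"
  unfolding kobayashi_def hahn_def
proof (rule cInf_superset_mono[OF _ bdd_below_cmod])
  show "{cmod \<alpha> |\<alpha> f. f \<in> hol_discs D \<and> inj_on f (ball 0 1) \<and> f 0 = z \<and>
      (\<alpha> * fst (disc_deriv0 f), \<alpha> * snd (disc_deriv0 f)) = X} \<noteq> {}"
    using hahn_set_nonempty[OF assms, of X] by blast
qed blast

lemma hahn_lessD:
  assumes "open D" "z \<in> D" "hahn D z X < c"
  shows "\<exists>\<alpha> f. cmod \<alpha> < c \<and> f \<in> hol_discs D \<and> inj_on f (ball 0 1) \<and> f 0 = z \<and>
      (\<alpha> * fst (disc_deriv0 f), \<alpha> * snd (disc_deriv0 f)) = X"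
proof -
  define S where "S = {cmod \<alpha> |\<alpha> f. f \<in> hol_discs D \<and> inj_on f (ball 0 1) \<and> f 0 = z \<and>
      (\<alpha> * fst (disc_deriv0 f), \<alpha> * snd (disc_deriv0 f)) = X}"
  have "S \<noteq> {}" using hahn_set_nonempty[OF assms(1,2), of X] unfolding S_def by blast
  moreover have "Inf S < c" using assms(3) by (simp add: hahn_def S_def)
  ultimately obtain x where "x \<in> S" "x < c" using cInf_lessD[of S c] by blast
  then show ?thesis unfolding S_def by blast
qed

text \<open>A competitor for the Kobayashi metric with multiplier \<open>\<alpha>\<close> becomes an
  injective one with multiplier \<open>\<alpha> / \<theta>\<close>, and \<open>\<theta>\<close>
  tends to 1. If \<open>X\<close> is nonzero, at most one component has derivative 0, and that case
  is \<open>inj_match_degenerate\<close>.\<close>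

lemma hahn_eq_kobayashiI:
  assumes "open D1" "open D2"
    and dense: "\<And>f1 f2 \<theta>. disc_map D1 f1 \<Longrightarrow> disc_map D2 f2 \<Longrightarrow> deriv f1 0 \<noteq> 0 \<Longrightarrow> deriv f2 0 \<noteq> 0
      \<Longrightarrow> 0 < \<theta> \<Longrightarrow> \<theta> < 1 \<Longrightarrow> inj_match D1 D2 f1 f2 \<theta>"
  shows "hahn_eq_kobayashi (D1 \<times> D2)"
  unfolding hahn_eq_kobayashi_def
proof (intro ballI allI antisym)
  fix z X assume z: "z \<in> D1 \<times> D2"
  have op: "open (D1 \<times> D2)" using assms by (intro open_Times)
  show "kobayashi (D1 \<times> D2) z X \<le> hahn (D1 \<times> D2) z X" by (rule kobayashi_le_hahn[OF op z])
  show "hahn (D1 \<times> D2) z X \<le> kobayashi (D1 \<times> D2) z X"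
    unfolding kobayashi_def
  proof (rule cInf_greatest)
    show "{cmod \<alpha> |\<alpha> f. f \<in> hol_discs (D1 \<times> D2) \<and> f 0 = z \<and>
      (\<alpha> * fst (disc_deriv0 f), \<alpha> * snd (disc_deriv0 f)) = X} \<noteq> {}"
      using hahn_set_nonempty[OF op z, of X] by blast
    fix x assume "x \<in> {cmod \<alpha> |\<alpha> f. f \<in> hol_discs (D1 \<times> D2) \<and> f 0 = z \<and>
      (\<alpha> * fst (disc_deriv0 f), \<alpha> * snd (disc_deriv0 f)) = X}"
    then obtain \<alpha> f where f: "x = cmod \<alpha>" "f \<in> hol_discs (D1 \<times> D2)" "f 0 = z"
      and X: "(\<alpha> * fst (disc_deriv0 f), \<alpha> * snd (disc_deriv0 f)) = X" by blast
    show "hahn (D1 \<times> D2) z X \<le> x"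
    proof (cases "X = 0")
      case True
      obtain \<beta> g where "g \<in> hol_discs (D1 \<times> D2)" "inj_on g (ball 0 1)" "g 0 = z"
        "(\<beta> * fst (disc_deriv0 g), \<beta> * snd (disc_deriv0 g)) = X" "\<beta> = 0"
        using hahn_set_nonempty[OF op z, of X] True by auto
      then have "hahn (D1 \<times> D2) z X \<le> cmod \<beta>"
        unfolding hahn_def by (intro cInf_lower[OF _ bdd_below_cmod]) blast
      also have "\<dots> \<le> x" using \<open>\<beta> = 0\<close> f by simp
      finally show ?thesis .
    next
      case False
      define f1 where "f1 t = fst (f t)" for t
      define f2 where "f2 t = snd (f t)" for t
      have f12: "disc_map D1 f1" "disc_map D2 f2"
        using f(2) unfolding hol_discs_def f1_def f2_def disc_map_def by auto
      have X': "X = (\<alpha> * deriv f1 0, \<alpha> * deriv f2 0)"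
        using X unfolding disc_deriv0_def f1_def f2_def by simp
      then have nz: "deriv f1 0 \<noteq> 0 \<or> deriv f2 0 \<noteq> 0" using False by (auto simp: zero_prod_def)
      have le: "hahn (D1 \<times> D2) z X \<le> x / \<theta>" if \<theta>: "0 < \<theta>" "\<theta> < 1" for \<theta>
      proof -
        have "inj_match D1 D2 f1 f2 \<theta>"
          using dense[OF f12 _ _ \<theta>] inj_match_degenerate[OF f12 assms(1) _ _ \<theta>]
            inj_match_swap[OF inj_match_degenerate[OF f12(2,1) assms(2) _ _ \<theta>]] nz by blast
        then obtain g1 g2 where g: "disc_map D1 g1" "disc_map D2 g2" "g1 0 = f1 0" "g2 0 = f2 0"
          "deriv g1 0 = \<theta> * deriv f1 0" "deriv g2 0 = \<theta> * deriv f2 0"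
          "\<forall>s t. norm s < 1 \<longrightarrow> norm t < 1 \<longrightarrow> g1 s = g1 t \<longrightarrow> g2 s = g2 t \<longrightarrow> s = t"
          unfolding inj_match_def by blast
        define g where "g t = (g1 t, g2 t)" for t
        have "g \<in> hol_discs (D1 \<times> D2)" using g(1,2) by (auto simp: hol_discs_def disc_map_def g_def)
        moreover have "inj_on g (ball 0 1)" using g(7) by (auto simp: inj_on_def g_def)
        moreover have "g 0 = z" using f(3) g(3,4) by (simp add: g_def f1_def f2_def)
        moreover have "(\<alpha> / \<theta> * fst (disc_deriv0 g), \<alpha> / \<theta> * snd (disc_deriv0 g)) = X"
          using \<theta> by (simp add: disc_deriv0_def g_def g(5,6) X')
        ultimately have "hahn (D1 \<times> D2) z X \<le> cmod (\<alpha> / \<theta>)"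
          unfolding hahn_def by (intro cInf_lower[OF _ bdd_below_cmod]) blast
        then show ?thesis using f \<theta> by (simp add: norm_divide)
      qed
      show ?thesis
      proof (rule field_le_mult_one_interval)
        fix \<theta> :: real assume "0 < \<theta>" "\<theta> < 1"
        with le[of \<theta>] show "\<theta> * hahn (D1 \<times> D2) z X \<le> x" by (simp add: field_simps)
      qed
    qed
  qed
qed

lemma hahn_eq_kobayashi_if_dense:
  assumes "open D1" "open D2" "(\<forall>z\<in>D1. inj_dense_at D1 D2 z) \<or> (\<forall>z\<in>D2. inj_dense_at D2 D1 z)"
  shows "hahn_eq_kobayashi (D1 \<times> D2)"
proof (rule hahn_eq_kobayashiI[OF assms(1,2)])
  fix f1 f2 \<theta> assume f: "disc_map D1 f1" "disc_map D2 f2" "deriv f1 0 \<noteq> 0" "deriv f2 0 \<noteq> 0" "0 < \<theta>" "\<theta> < (1::real)"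
  have "f1 0 \<in> D1" "f2 0 \<in> D2" using disc_map_mem[OF f(1), of 0] disc_map_mem[OF f(2), of 0] by auto
  then show "inj_match D1 D2 f1 f2 \<theta>"
    using assms(3) f inj_match_swap unfolding inj_dense_at_def by blast
qed

lemma hahn_eq_kobayashi_simply_connected:
  assumes "domain_C D1" "domain_C D2" "simply_connected D1 \<or> simply_connected D2"
  shows "hahn_eq_kobayashi (D1 \<times> D2)"
  using assms inj_dense_at_simply_connected
  by (intro hahn_eq_kobayashi_if_dense) (auto simp: domain_C_def)

lemma inj_dense_at_biholomorphic_punctured_plane:
  assumes "open D1" "biholomorphic D1 (- {0})"
  shows "inj_dense_at D1 D2 z"
proof -
  obtain u v where "u holomorphic_on D1" "v holomorphic_on (- {0})"
    "\<forall>z\<in>D1. u z \<in> - {0} \<and> v (u z) = z" "\<forall>w\<in>- {0}. v w \<in> D1 \<and> u (v w) = w"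
    using assms(2) unfolding biholomorphic_def by blast
  then show ?thesis
    by (rule inj_dense_at_biholomorphic) (use assms(1) inj_dense_at_punctured_plane in auto)
qed

lemma hahn_eq_kobayashi_punctured_plane:
  assumes "domain_C D1" "domain_C D2" "biholomorphic D1 (- {0}) \<or> biholomorphic D2 (- {0})"
  shows "hahn_eq_kobayashi (D1 \<times> D2)"
  using assms inj_dense_at_biholomorphic_punctured_plane
  by (intro hahn_eq_kobayashi_if_dense) (auto simp: domain_C_def)

section \<open>Uniformization of plane domains\<close>

text \<open>This lifting property plays the role of being a holomorphic covering map. Unlike that of a
  covering, it needs no connectedness of \<open>\<Omega>\<close> or \<open>D\<close> and passes directly to limits.\<close>

definition disc_lifting :: "complex set \<Rightarrow> (complex \<Rightarrow> complex) \<Rightarrow> complex set \<Rightarrow> bool" where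
  "disc_lifting \<Omega> p D \<longleftrightarrow> open \<Omega> \<and> p holomorphic_on \<Omega> \<and> p ` \<Omega> \<subseteq> D \<and>
     (\<forall>a\<in>\<Omega>. \<forall>g. disc_map D g \<longrightarrow> g 0 = p a \<longrightarrow>
        (\<exists>\<phi>. disc_map \<Omega> \<phi> \<and> \<phi> 0 = a \<and> (\<forall>t. norm t < 1 \<longrightarrow> p (\<phi> t) = g t)))"

lemma disc_liftingI:
  assumes "open \<Omega>" "p holomorphic_on \<Omega>" "\<And>a. a \<in> \<Omega> \<Longrightarrow> p a \<in> D"
    and "\<And>a g. a \<in> \<Omega> \<Longrightarrow> disc_map D g \<Longrightarrow> g 0 = p a \<Longrightarrow>
        \<exists>\<phi>. disc_map \<Omega> \<phi> \<and> \<phi> 0 = a \<and> (\<forall>t. norm t < 1 \<longrightarrow> p (\<phi> t) = g t)"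
  shows "disc_lifting \<Omega> p D"
  using assms unfolding disc_lifting_def by blast

lemma disc_lifting_open: "disc_lifting \<Omega> p D \<Longrightarrow> open \<Omega>"
  and disc_lifting_holomorphic: "disc_lifting \<Omega> p D \<Longrightarrow> p holomorphic_on \<Omega>"
  and disc_lifting_mem: "disc_lifting \<Omega> p D \<Longrightarrow> a \<in> \<Omega> \<Longrightarrow> p a \<in> D"
  unfolding disc_lifting_def by auto

lemma disc_lifting_lift:
  assumes "disc_lifting \<Omega> p D" "a \<in> \<Omega>" "disc_map D g" "g 0 = p a"
  obtains \<phi> where "disc_map \<Omega> \<phi>" "\<phi> 0 = a" "\<And>t. norm t < 1 \<Longrightarrow> p (\<phi> t) = g t"
  using assms unfolding disc_lifting_def by blast

lemma disc_lifting_compose: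
  assumes p: "disc_lifting \<Omega> p D" and q: "disc_lifting \<Omega>' q \<Omega>"
  shows "disc_lifting \<Omega>' (\<lambda>w. p (q w)) D"
proof (rule disc_liftingI)
  show "open \<Omega>'" using q by (rule disc_lifting_open)
  have "q ` \<Omega>' \<subseteq> \<Omega>" using disc_lifting_mem[OF q] by blast
  then show "(\<lambda>w. p (q w)) holomorphic_on \<Omega>'"
    using holomorphic_on_compose_gen[OF disc_lifting_holomorphic[OF q] disc_lifting_holomorphic[OF p]]
    by (simp add: o_def)
  show "p (q a) \<in> D" if "a \<in> \<Omega>'" for a
    using disc_lifting_mem[OF p disc_lifting_mem[OF q that]] .
  fix a g assume a: "a \<in> \<Omega>'" and g: "disc_map D g" "g 0 = p (q a)"
  obtain \<phi> where \<phi>: "disc_map \<Omega> \<phi>" "\<phi> 0 = q a" "\<And>t. norm t < 1 \<Longrightarrow> p (\<phi> t) = g t"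
    using disc_lifting_lift[OF p disc_lifting_mem[OF q a] g] by blast
  obtain \<eta> where \<eta>: "disc_map \<Omega>' \<eta>" "\<eta> 0 = a" "\<And>t. norm t < 1 \<Longrightarrow> q (\<eta> t) = \<phi> t"
    using disc_lifting_lift[OF q a \<phi>(1,2)] by blast
  show "\<exists>\<phi>. disc_map \<Omega>' \<phi> \<and> \<phi> 0 = a \<and> (\<forall>t. norm t < 1 \<longrightarrow> p (q (\<phi> t)) = g t)"
    using \<phi> \<eta> by auto
qed

lemma disc_lifting_biholomorphic:
  assumes "open \<Omega>" "u holomorphic_on \<Omega>" "v holomorphic_on D"
    and "\<And>z. z \<in> \<Omega> \<Longrightarrow> u z \<in> D \<and> v (u z) = z" "\<And>w. w \<in> D \<Longrightarrow> v w \<in> \<Omega> \<and> u (v w) = w"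
  shows "disc_lifting \<Omega> u D"
proof (rule disc_liftingI[OF assms(1,2)])
  fix a g assume a: "a \<in> \<Omega>" and g: "disc_map D g" "g 0 = u a"
  have "disc_map \<Omega> (\<lambda>t. v (g t))"
    using assms(5) by (intro disc_map_compose[OF g(1) assms(3)]) blast
  moreover have "v (g 0) = a" using g(2) assms(4) a by simp
  moreover have "u (v (g t)) = g t" if "norm t < 1" for t
    using assms(5) disc_map_mem[OF g(1) that] by blast
  ultimately show "\<exists>\<phi>. disc_map \<Omega> \<phi> \<and> \<phi> 0 = a \<and> (\<forall>t. norm t < 1 \<longrightarrow> u (\<phi> t) = g t)"
    by (intro exI[of _ "\<lambda>t. v (g t)"]) simp
qed (use assms(4) in auto)

lemma disc_lifting_affine:
  assumes "open D" "c \<noteq> 0"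
  shows "disc_lifting {w. z + c * w \<in> D} (\<lambda>w. z + c * w) D"
proof (rule disc_lifting_biholomorphic[where v = "\<lambda>w. (w - z) / c"])
  have "open ((\<lambda>w. z + c * w) -` D)"
    by (intro open_vimage assms continuous_intros)
  then show "open {w. z + c * w \<in> D}" by (simp add: vimage_def)
qed (use assms(2) in \<open>auto intro!: holomorphic_intros\<close>)

section \<open>Koebe's square root operation\<close>

lemma disc_lifting_Moebius:
  assumes "open \<Omega>" "\<Omega> \<subseteq> ball 0 1" "norm w < 1"
  shows "disc_lifting {z \<in> ball 0 1. Moebius_function 0 w z \<in> \<Omega>} (Moebius_function 0 w) \<Omega>"
proof (rule disc_lifting_biholomorphic[where v = "Moebius_function 0 (- w)"])
  have h: "Moebius_function 0 w holomorphic_on ball 0 1"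
    by (rule Moebius_function_holomorphic[OF assms(3)])
  have "open (ball 0 1 \<inter> Moebius_function 0 w -` \<Omega>)"
    by (rule continuous_open_preimage[OF holomorphic_on_imp_continuous_on[OF h]]) (use assms in auto)
  then show "open {z \<in> ball 0 1. Moebius_function 0 w z \<in> \<Omega>}" by (simp add: vimage_def Int_def)
  show "Moebius_function 0 w holomorphic_on {z \<in> ball 0 1. Moebius_function 0 w z \<in> \<Omega>}"
    by (rule holomorphic_on_subset[OF h]) auto
  show "Moebius_function 0 (- w) holomorphic_on \<Omega>"
    by (rule holomorphic_on_subset[OF Moebius_function_holomorphic]) (use assms in auto)
  show "Moebius_function 0 w z \<in> \<Omega> \<and> Moebius_function 0 (- w) (Moebius_function 0 w z) = z"
    if "z \<in> {z \<in> ball 0 1. Moebius_function 0 w z \<in> \<Omega>}" for z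
    using that assms Moebius_function_compose[of "- w" w z] by auto
  show "Moebius_function 0 (- w) z \<in> {z \<in> ball 0 1. Moebius_function 0 w z \<in> \<Omega>} \<and>
      Moebius_function 0 w (Moebius_function 0 (- w) z) = z" if "z \<in> \<Omega>" for z
    using that assms Moebius_function_compose[of w "- w" z] Moebius_function_norm_lt_1[of "- w" z 0]
    by auto
qed

text \<open>A disc avoiding 0 has a holomorphic square root because the unit disc is simply
  connected; the choice of sign lets it start at \<open>a\<close>.\<close>

lemma disc_lifting_square:
  assumes "open \<Omega>" "0 \<notin> \<Omega>"
  shows "disc_lifting {w. w\<^sup>2 \<in> \<Omega>} (\<lambda>w. w\<^sup>2) \<Omega>"
proof (rule disc_liftingI)
  have "open ((\<lambda>w. w\<^sup>2) -` \<Omega>)" by (intro open_vimage assms continuous_intros)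
  then show "open {w. w\<^sup>2 \<in> \<Omega>}" by (simp add: vimage_def)
  show "(\<lambda>w. w\<^sup>2) holomorphic_on {w. w\<^sup>2 \<in> \<Omega>}" by (intro holomorphic_intros)
  fix a g assume a: "a \<in> {w. w\<^sup>2 \<in> \<Omega>}" and g: "disc_map \<Omega> g" "g 0 = a\<^sup>2"
  have "simply_connected (ball (0::complex) 1)" by (simp add: convex_imp_simply_connected)
  moreover have "g holomorphic_on ball 0 1" "\<forall>z\<in>ball 0 1. g z \<noteq> 0"
    using g assms by (auto simp: disc_map_def)
  ultimately obtain h where h: "h holomorphic_on ball 0 1" "\<And>z. z \<in> ball 0 1 \<Longrightarrow> g z = (h z)\<^sup>2"
    using simply_connected_eq_holomorphic_sqrt[of "ball 0 1"] by (metis open_ball)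
  have "(h 0)\<^sup>2 = a\<^sup>2" using g h(2)[of 0] by simp
  then consider "h 0 = a" | "- h 0 = a" using power2_eq_iff by metis
  then obtain s :: complex where s: "s\<^sup>2 = 1" "s * h 0 = a"
    by cases (use that[of 1] that[of "-1"] in auto)
  have sq: "(s * h t)\<^sup>2 = g t" if "norm t < 1" for t
    using h(2)[of t] s that by (simp add: power_mult_distrib)
  have "disc_map {w. w\<^sup>2 \<in> \<Omega>} (\<lambda>t. s * h t)"
    using disc_map_mem[OF g(1)] by (intro disc_mapI holomorphic_intros h) (simp add: sq)
  then show "\<exists>\<phi>. disc_map {w. w\<^sup>2 \<in> \<Omega>} \<phi> \<and> \<phi> 0 = a \<and> (\<forall>t. norm t < 1 \<longrightarrow> (\<phi> t)\<^sup>2 = g t)"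
    using s sq by blast
qed auto

lemma Moebius_function_has_derivative:
  assumes "1 - cnj w * z \<noteq> 0"
  shows "(Moebius_function 0 w has_field_derivative (1 - w * cnj w) / (1 - cnj w * z)\<^sup>2) (at z)"
  unfolding Moebius_function_simple[abs_def]
  by (rule derivative_eq_intros refl assms)+
    (use assms in \<open>simp add: power2_eq_square algebra_simps\<close>)

text \<open>Koebe's square root: a point \<open>b\<close> of the disc missed by \<open>\<Omega>\<close> is a branch point
  that costs nothing, and lifting through it shrinks the derivative by a definite factor.\<close>

lemma disc_lifting_Koebe_step:
  assumes \<Omega>: "open \<Omega>" "\<Omega> \<subseteq> ball 0 1" "0 \<in> \<Omega>" and b: "norm b < 1" "b \<notin> \<Omega>"
  obtains \<Omega>' q where "disc_lifting \<Omega>' q \<Omega>" "\<Omega>' \<subseteq> ball 0 1" "0 \<in> \<Omega>'" "q 0 = 0"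
    "norm (deriv q 0) = 2 * sqrt (norm b) / (1 + norm b)"
proof -
  \<comment> \<open>\<open>M (-b)\<close> sends 0 to the missed point \<open>b\<close>, so squaring
    has no branch point over \<open>\<Omega>1\<close>. It sends \<open>-b\<close> to 0, and
    \<open>M (-\<beta>)\<close> sends 0 to \<open>\<beta>\<close>; with \<open>\<beta>\<close> a
    square root of \<open>-b\<close> the composite \<open>q\<close> fixes 0.\<close>
  define \<beta> where "\<beta> = csqrt (- b)"
  have \<beta>2: "\<beta>\<^sup>2 = - b" by (simp add: \<beta>_def)
  have n\<beta>: "(norm \<beta>)\<^sup>2 = norm b" using \<beta>2 by (metis norm_minus_cancel norm_power)
  then have s\<beta>: "norm \<beta> = sqrt (norm b)" by (metis norm_ge_zero real_sqrt_unique)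
  have \<beta>1: "norm \<beta> < 1" using b s\<beta> by simp
  define M where "M = Moebius_function 0"
  define \<Omega>1 where "\<Omega>1 = {z \<in> ball 0 1. M (-b) z \<in> \<Omega>}"
  define \<Omega>2 where "\<Omega>2 = {w. w\<^sup>2 \<in> \<Omega>1}"
  define \<Omega>3 where "\<Omega>3 = {z \<in> ball 0 1. M (-\<beta>) z \<in> \<Omega>2}"
  define q where "q z = M (-b) ((M (-\<beta>) z)\<^sup>2)" for z
  have L1: "disc_lifting \<Omega>1 (M (-b)) \<Omega>"
    unfolding \<Omega>1_def M_def using \<Omega> b by (intro disc_lifting_Moebius) auto
  have "M (-b) 0 = b" by (simp add: M_def Moebius_function_simple)
  then have "0 \<notin> \<Omega>1" using b by (simp add: \<Omega>1_def)
  then have L2: "disc_lifting \<Omega>2 (\<lambda>w. w\<^sup>2) \<Omega>1"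
    unfolding \<Omega>2_def by (intro disc_lifting_square disc_lifting_open[OF L1])
  have "\<Omega>2 \<subseteq> ball 0 1"
    by (auto simp: \<Omega>2_def \<Omega>1_def norm_power power_less_one_iff abs_square_less_1)
  then have L3: "disc_lifting \<Omega>3 (M (-\<beta>)) \<Omega>2"
    unfolding \<Omega>3_def M_def using \<beta>1 disc_lifting_open[OF L2] by (intro disc_lifting_Moebius) auto
  have L: "disc_lifting \<Omega>3 q \<Omega>"
    unfolding q_def using disc_lifting_compose[OF disc_lifting_compose[OF L1 L2] L3] .
  have M\<beta>: "M (-\<beta>) 0 = \<beta>" by (simp add: M_def Moebius_function_simple)
  have Mb: "M (-b) (-b) = 0" by (simp add: M_def Moebius_function_simple)
  have nb: "1 - b * cnj b \<noteq> 0"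
  proof
    assume "1 - b * cnj b = 0"
    then have "of_real ((norm b)\<^sup>2) = (1::complex)" by (simp only: complex_norm_square) simp
    then have "(norm b)\<^sup>2 = 1" using of_real_eq_1_iff by blast
    then show False using b norm_ge_zero[of b] by (auto simp: power2_eq_1_iff simp del: norm_ge_zero)
  qed
  have d1: "(M (-\<beta>) has_field_derivative (1 - \<beta> * cnj \<beta>)) (at 0)"
    unfolding M_def using Moebius_function_has_derivative[of "-\<beta>" 0] by simp
  have d2: "(M (-b) has_field_derivative 1 / (1 - b * cnj b)) (at (-b))"
    unfolding M_def using Moebius_function_has_derivative[of "-b" "-b"] nb
    by (simp add: power2_eq_square mult.commute)
  have d3: "((\<lambda>z. (M (-\<beta>) z)\<^sup>2) has_field_derivative 2 * \<beta> * (1 - \<beta> * cnj \<beta>)) (at 0)"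
    by (rule derivative_eq_intros d1 refl)+ (simp add: M\<beta>)
  have "(q has_field_derivative 1 / (1 - b * cnj b) * (2 * \<beta> * (1 - \<beta> * cnj \<beta>))) (at 0)"
    unfolding q_def by (rule DERIV_chain2[OF _ d3]) (simp add: M\<beta> \<beta>2 d2)
  then have dq: "deriv q 0 = 1 / (1 - b * cnj b) * (2 * \<beta> * (1 - \<beta> * cnj \<beta>))"
    by (rule DERIV_imp_deriv)
  have n1: "norm (1 - b * cnj b) = 1 - (norm b)\<^sup>2"
  proof -
    have "1 - b * cnj b = of_real (1 - (norm b)\<^sup>2)" by (simp only: of_real_diff of_real_1 complex_norm_square)
    then show ?thesis using b by (simp only: norm_of_real) (simp add: power_le_one)
  qed
  have n2: "norm (1 - \<beta> * cnj \<beta>) = 1 - norm b"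
  proof -
    have "1 - \<beta> * cnj \<beta> = of_real (1 - (norm \<beta>)\<^sup>2)" by (simp only: of_real_diff of_real_1 complex_norm_square)
    then show ?thesis using b n\<beta> by (simp only: norm_of_real)
  qed
  have "norm (deriv q 0) = 2 * sqrt (norm b) * (1 - norm b) / (1 - (norm b)\<^sup>2)"
    unfolding dq norm_mult norm_divide n1 n2 s\<beta> by simp
  also have "1 - (norm b)\<^sup>2 = (1 + norm b) * (1 - norm b)" by (simp add: power2_eq_square algebra_simps)
  finally have nd: "norm (deriv q 0) = 2 * sqrt (norm b) / (1 + norm b)" using b by simp
  have "q 0 = 0" by (simp add: q_def M\<beta> \<beta>2 Mb)
  moreover have "0 \<in> \<Omega>3" using b \<Omega>(3) by (simp add: \<Omega>3_def \<Omega>2_def \<Omega>1_def M\<beta> \<beta>2 Mb)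
  moreover have "\<Omega>3 \<subseteq> ball 0 1" by (auto simp: \<Omega>3_def)
  ultimately show thesis using that L nd by blast
qed

section \<open>Koebe's extremal problem on bounded open sets\<close>

lemma disc_lifting_deriv_ge:
  assumes p: "disc_lifting \<Omega> p D" and \<Omega>: "\<Omega> \<subseteq> ball 0 1" "0 \<in> \<Omega>" and g: "disc_map D g" "g 0 = p 0"
  shows "norm (deriv g 0) \<le> norm (deriv p 0)"
proof -
  obtain \<phi> where \<phi>: "disc_map \<Omega> \<phi>" "\<phi> 0 = 0" "\<And>t. norm t < 1 \<Longrightarrow> p (\<phi> t) = g t"
    using disc_lifting_lift[OF p \<Omega>(2) g] by blast
  have "(p has_field_derivative deriv p 0) (at (\<phi> 0))"
    using holomorphic_derivI[OF disc_lifting_holomorphic[OF p] disc_lifting_open[OF p] \<Omega>(2)] \<phi>(2) by simp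
  then have "((\<lambda>t. p (\<phi> t)) has_field_derivative deriv p 0 * deriv \<phi> 0) (at 0)"
    using disc_map_has_derivative[OF \<phi>(1)] DERIV_chain2 by blast
  then have "(g has_field_derivative deriv p 0 * deriv \<phi> 0) (at 0)"
    by (rule has_field_derivative_transform_within_open[of _ _ _ "ball 0 1"]) (use \<phi>(3) in auto)
  then have "deriv g 0 = deriv p 0 * deriv \<phi> 0" by (rule DERIV_imp_deriv)
  moreover have "norm (deriv \<phi> 0) \<le> 1"
  proof (rule Schwarz_Lemma(2)[of \<phi> 0])
    show "norm (\<phi> t) < 1" if "norm t < 1" for t using disc_map_mem[OF \<phi>(1) that] \<Omega>(1) by auto
  qed (use \<phi> disc_map_holomorphic in auto)
  ultimately show ?thesis by (simp add: norm_mult mult_left_le)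
qed

text \<open>In the square roots \<open>a\<close> and \<open>b\<close>, the cross-multiplied
  difference is \<open>(b - a) * (1 - a * b)\<close>. Monotonicity makes the shrinking factor
  uniform over all missed points of \<open>ball 0 r\<close>.\<close>

lemma Koebe_factor_mono:
  assumes "0 \<le> x" "x \<le> y" "y \<le> (1::real)"
  shows "2 * sqrt x / (1 + x) \<le> 2 * sqrt y / (1 + y)"
proof -
  define a b where "a = sqrt x" and "b = sqrt y"
  have a: "0 \<le> a" "a \<le> b" "b \<le> 1" using assms by (auto simp: a_def b_def)
  have "a * b \<le> 1" using a by (intro mult_le_one) auto
  then have "0 \<le> (b - a) * (1 - a * b)" using a by simp
  then have "a * (1 + b\<^sup>2) \<le> b * (1 + a\<^sup>2)" by (simp add: algebra_simps power2_eq_square)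
  then have "2 * a / (1 + a\<^sup>2) \<le> 2 * b / (1 + b\<^sup>2)" by (simp add: divide_simps add_pos_nonneg) 
  then show ?thesis using assms by (simp add: a_def b_def)
qed

lemma Koebe_factor_less_1:
  assumes "0 \<le> r" "r < (1::real)"
  shows "2 * sqrt r / (1 + r) < 1"
proof -
  have "sqrt r \<noteq> 1" using assms by auto
  then have "0 < (1 - sqrt r)\<^sup>2" by simp
  also have "(1 - sqrt r)\<^sup>2 = 1 + r - 2 * sqrt r" using assms by (simp add: power2_diff)
  finally show ?thesis using assms by simp
qed

text \<open>Over all liftings on subsets of the unit disc with \<open>p 0 = z\<close>, the infimum
  of \<open>norm (deriv p 0)\<close> is positive: a small affine disc about \<open>z\<close> lifts,
  and the Schwarz lemma bounds its derivative. If a near-minimiser missed a point of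
  \<open>ball 0 r\<close>, a Koebe step would bring it below the infimum. Asking for
  \<open>ball 0 r\<close> only avoids proving that a minimiser exists.\<close>

lemma bounded_disc_lifting_exists:
  assumes D: "open D" "bounded D" and z: "z \<in> D" and r: "0 < r" "r < 1"
  obtains \<Omega> p where "disc_lifting \<Omega> p D" "ball 0 r \<subseteq> \<Omega>" "\<Omega> \<subseteq> ball 0 1" "p 0 = z"
proof -
  define ok where "ok \<Omega> p \<longleftrightarrow> disc_lifting \<Omega> p D \<and> \<Omega> \<subseteq> ball 0 1 \<and> 0 \<in> \<Omega> \<and> p 0 = z" for \<Omega> p
  define A where "A = {norm (deriv p 0) | \<Omega> p. ok \<Omega> p}"
  obtain R where R: "0 < R" "D \<subseteq> ball z R"
    using D(2) bounded_subset_ballD by blast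
  \<comment> \<open>Boundedness of \<open>D\<close> provides a first competitor: \<open>D\<close>
    itself, scaled into the unit disc.\<close>
  have "ok {w. z + of_real R * w \<in> D} (\<lambda>w. z + of_real R * w)"
  proof -
    have "norm w < 1" if "z + of_real R * w \<in> D" for w
    proof -
      have "z + of_real R * w \<in> ball z R" using that R(2) by blast
      then have "R * norm w < R" using R(1) by (simp add: dist_norm norm_mult)
      then show ?thesis using R(1) by simp
    qed
    then show ?thesis unfolding ok_def using disc_lifting_affine[OF D(1)] R(1) z by auto
  qed
  then have ne: "A \<noteq> {}" unfolding A_def by blast
  obtain \<rho> where \<rho>: "0 < \<rho>" "ball z \<rho> \<subseteq> D" using D(1) z open_contains_ball by blast
  have lb: "\<rho> \<le> x" if xA: "x \<in> A" for x
  proof -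
    obtain \<Omega> p where x: "x = norm (deriv p 0)" and p: "ok \<Omega> p" using xA unfolding A_def by blast
    have "disc_map D (\<lambda>t. z + of_real \<rho> * t)"
    proof (intro disc_mapI holomorphic_intros)
      fix t :: complex assume "norm t < 1"
      then have "z + of_real \<rho> * t \<in> ball z \<rho>" using \<rho>(1) by (simp add: dist_norm norm_mult)
      then show "z + of_real \<rho> * t \<in> D" using \<rho>(2) by blast
    qed
    then have "norm (deriv (\<lambda>t. z + of_real \<rho> * t) 0) \<le> norm (deriv p 0)"
      using p unfolding ok_def by (intro disc_lifting_deriv_ge[of \<Omega> p D]) auto
    moreover have "deriv (\<lambda>t. z + of_real \<rho> * t) 0 = of_real \<rho>"
      by (intro DERIV_imp_deriv) (auto intro!: derivative_eq_intros)
    ultimately show ?thesis using \<rho>(1) x by simp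
  qed
  then have bdd: "bdd_below A" by (intro bdd_belowI)
  define m where "m = Inf A"
  have m: "0 < m" using \<rho>(1) cInf_greatest[OF ne lb] by (simp add: m_def)
  define k where "k = 2 * sqrt r / (1 + r)"
  have k: "0 < k" "k < 1" using r Koebe_factor_less_1[of r] by (auto simp: k_def)
  \<comment> \<open>\<open>k\<close> bounds the factor of every Koebe step at a missed point of
    \<open>ball 0 r\<close>, so a competitor below \<open>m / k\<close> is good enough to be pushed
    below \<open>m\<close>.\<close>
  have "m < m / k" using m k by (simp add: field_simps)
  then have "Inf A < m / k" by (simp add: m_def)
  from cInf_lessD[OF ne this] obtain x where x: "x \<in> A" "x < m / k" by blast
  obtain \<Omega> p where p: "x = norm (deriv p 0)" "ok \<Omega> p" using x(1) unfolding A_def by blast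
  then have p': "disc_lifting \<Omega> p D" "\<Omega> \<subseteq> ball 0 1" "0 \<in> \<Omega>" "p 0 = z" by (auto simp: ok_def)
  have "b \<in> \<Omega>" if "b \<in> ball 0 r" for b
  proof (rule ccontr)
    assume b: "b \<notin> \<Omega>"
    have b1: "norm b < 1" "norm b \<le> r" using that r by auto
    obtain \<Omega>' q where q: "disc_lifting \<Omega>' q \<Omega>" "\<Omega>' \<subseteq> ball 0 1" "0 \<in> \<Omega>'" "q 0 = 0"
      "norm (deriv q 0) = 2 * sqrt (norm b) / (1 + norm b)"
      by (rule disc_lifting_Koebe_step[OF disc_lifting_open[OF p'(1)] p'(2,3) b1(1) b])
    have "ok \<Omega>' (\<lambda>w. p (q w))"
      unfolding ok_def using disc_lifting_compose[OF p'(1) q(1)] q p' by simp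
    then have "norm (deriv (\<lambda>w. p (q w)) 0) \<in> A" unfolding A_def by blast
    then have "m \<le> norm (deriv (\<lambda>w. p (q w)) 0)"
      unfolding m_def by (rule cInf_lower[OF _ bdd])
    also have "deriv (\<lambda>w. p (q w)) 0 = deriv p 0 * deriv q 0"
    proof (rule DERIV_imp_deriv, rule DERIV_chain2[of p])
      show "(p has_field_derivative deriv p 0) (at (q 0))"
        using holomorphic_derivI[OF disc_lifting_holomorphic[OF p'(1)] disc_lifting_open[OF p'(1)] p'(3)] q(4) by simp
      show "(q has_field_derivative deriv q 0) (at 0)"
        by (rule holomorphic_derivI[OF disc_lifting_holomorphic[OF q(1)] disc_lifting_open[OF q(1)] q(3)])
    qed
    also have "norm \<dots> \<le> x * k"
      unfolding norm_mult p(1) q(5) k_def using Koebe_factor_mono[OF _ b1(2)] r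
      by (intro mult_left_mono) auto
    also have "\<dots> < m" using x(2) k by (simp add: field_simps)
    finally show False by simp
  qed
  then show thesis using that p' by blast
qed

section \<open>Limits of lifting maps\<close>

lemma tendsto_compose_uniform_limit:
  fixes P :: "nat \<Rightarrow> complex \<Rightarrow> complex"
  assumes S: "open S" "x \<in> S" and P: "\<And>K. compact K \<Longrightarrow> K \<subseteq> S \<Longrightarrow> uniform_limit K P p sequentially"
    and p: "continuous_on S p" and X: "X \<longlonglongrightarrow> x"
  shows "(\<lambda>n. P n (X n)) \<longlonglongrightarrow> p x"
proof -
  obtain e where e: "0 < e" "cball x e \<subseteq> S" using S open_contains_cball by blast
  have ul: "uniform_limit (cball x e) P p sequentially" using P e by simp
  have ev: "eventually (\<lambda>n. X n \<in> cball x e) sequentially"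
    using tendstoD[OF X e(1)] by eventually_elim (simp add: dist_commute)
  have "isCont p x" using p S continuous_on_eq_continuous_at by blast
  then have 1: "(\<lambda>n. p (X n)) \<longlonglongrightarrow> p x" using X by (rule isCont_tendsto_compose)
  have "(\<lambda>n. P n (X n) - p (X n)) \<longlonglongrightarrow> 0"
  proof (rule tendstoI)
    fix d :: real assume "0 < d"
    from uniform_limitD[OF ul this] ev
    show "eventually (\<lambda>n. dist (P n (X n) - p (X n)) 0 < d) sequentially"
      by eventually_elim (simp add: dist_norm)
  qed
  from tendsto_add[OF this 1] show ?thesis by simp
qed

text \<open>The limit of the lifts stays inside the disc by the maximum principle.\<close>

lemma disc_lift_limit:
  fixes P :: "nat \<Rightarrow> complex \<Rightarrow> complex"
  assumes P: "\<And>K. compact K \<Longrightarrow> K \<subseteq> ball 0 1 \<Longrightarrow> uniform_limit K P p sequentially"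
    and p: "continuous_on (ball 0 1) p" and a: "norm a < 1" and R: "R \<longlonglongrightarrow> 1"
    and \<phi>: "\<And>n. disc_map (ball 0 (R n)) (\<phi> n)" "\<And>n. \<phi> n 0 = a"
    and eq: "\<And>n t. norm t < 1 \<Longrightarrow> P n (\<phi> n t) = G n t"
    and G: "\<And>t. norm t < 1 \<Longrightarrow> (\<lambda>n. G n t) \<longlonglongrightarrow> g t"
  shows "\<exists>\<phi>. disc_map (ball 0 1) \<phi> \<and> \<phi> 0 = a \<and> (\<forall>t. norm t < 1 \<longrightarrow> p (\<phi> t) = g t)"
proof -
  have le: "norm (\<phi> n t) \<le> R n" if "norm t < 1" for n t
    using disc_map_mem[OF \<phi>(1) that, of n] by simp
  have "Bseq R" using R by (intro convergent_imp_Bseq convergentI)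
  then obtain B where B: "\<And>n. norm (R n) \<le> B" by (auto simp: Bseq_def)
  have bd: "\<exists>B. \<forall>h\<in>range \<phi>. \<forall>z\<in>K. norm (h z) \<le> B" if "K \<subseteq> ball 0 1" for K
  proof (intro exI[of _ B] ballI)
    fix h z assume "h \<in> range \<phi>" "z \<in> K"
    then obtain n where "h = \<phi> n" by blast
    moreover have "norm z < 1" using that \<open>z \<in> K\<close> by auto
    ultimately show "norm (h z) \<le> B" using le[of z n] B[of n] by simp
  qed
  obtain f r where f: "f holomorphic_on ball 0 1" and r: "strict_mono (r :: nat \<Rightarrow> nat)"
    and lim: "\<And>x. x \<in> ball 0 1 \<Longrightarrow> ((\<lambda>n. \<phi> (r n) x) \<longlonglongrightarrow> f x)"
  proof (rule Montel[of "ball 0 1" "range \<phi>" \<phi>])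
    show "h holomorphic_on ball 0 1" if "h \<in> range \<phi>" for h
      using that \<phi>(1) disc_map_holomorphic by blast
  qed (use bd in auto)
  have f0: "f 0 = a" using lim[of 0] by (simp add: \<phi>(2) LIMSEQ_const_iff)
  have f1: "norm (f t) \<le> 1" if "norm t < 1" for t
  proof (rule LIMSEQ_le)
    show "(\<lambda>n. norm (\<phi> (r n) t)) \<longlonglongrightarrow> norm (f t)" using lim[of t] that by (intro tendsto_norm) simp
    show "(\<lambda>n. R (r n)) \<longlonglongrightarrow> 1" using LIMSEQ_subseq_LIMSEQ[OF R r] by (simp add: o_def)
  qed (use le that in auto)
  have f2: "norm (f t) < 1" if t: "norm t < 1" for t
  proof (rule ccontr)
    assume "\<not> norm (f t) < 1"
    then have "f constant_on ball 0 1"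
      using order_trans[OF f1, of _ "norm (f t)"] t
      by (intro maximum_modulus_principle[OF f, of "ball 0 1" t]) auto
    then have "f t = f 0" using t by (auto simp: constant_on_def)
    then show False using f0 a \<open>\<not> norm (f t) < 1\<close> by simp
  qed
  have "p (f t) = g t" if t: "norm t < 1" for t
  proof (rule LIMSEQ_unique)
    have "uniform_limit K (\<lambda>n. P (r n)) p sequentially" if "compact K" "K \<subseteq> ball 0 1" for K
      using filterlim_compose[OF P[OF that] filterlim_subseq[OF r]] by (simp add: o_def)
    then show "(\<lambda>n. P (r n) (\<phi> (r n) t)) \<longlonglongrightarrow> p (f t)"
      using lim[of t] t f2[OF t] p
      by (intro tendsto_compose_uniform_limit[of "ball 0 1" "f t" "\<lambda>n. P (r n)" p "\<lambda>n. \<phi> (r n) t"]) auto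
    show "(\<lambda>n. P (r n) (\<phi> (r n) t)) \<longlonglongrightarrow> g t"
      using LIMSEQ_subseq_LIMSEQ[OF G[OF t] r] eq[OF t] by (simp add: o_def)
  qed
  then show ?thesis using f f0 f2 by (intro exI[of _ f]) (auto intro!: disc_mapI)
qed

lemma radii_tendsto_1: "(\<lambda>n. 1 - 1 / (real n + 2)) \<longlonglongrightarrow> 1"
proof -
  have "(\<lambda>n. 1 / (real n + 2)) \<longlonglongrightarrow> 0"
    using LIMSEQ_ignore_initial_segment[OF lim_1_over_n[where 'a = real], of 2]
    by (simp add: add.commute)
  from tendsto_diff[OF tendsto_const this, of 1] show ?thesis by simp
qed

text \<open>A disc \<open>g\<close> may approach the boundary of \<open>D\<close> and then lie in
  none of the sets \<open>D' n\<close>. So \<open>t \<mapsto> g (\<rho> t)\<close> is lifted first: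
  its image lies in a compact subset of \<open>D\<close>, hence in \<open>D' n\<close> with a margin
  for large \<open>n\<close>. Afterwards \<open>\<rho>\<close> tends to 1. Both passages are
  instances of \<open>disc_lift_limit\<close>.\<close>

lemma disc_lifting_limit:
  fixes P :: "nat \<Rightarrow> complex \<Rightarrow> complex"
  assumes L: "\<And>n. disc_lifting (\<Omega> n) (P n) (D' n)"
    and \<Omega>: "\<And>n. ball 0 1 \<subseteq> \<Omega> n" "\<And>n. \<Omega> n \<subseteq> ball 0 (R n)" and R: "R \<longlonglongrightarrow> 1"
    and D': "\<And>n. D' n \<subseteq> D" "\<And>K. compact K \<Longrightarrow> K \<subseteq> D \<Longrightarrow> eventually (\<lambda>n. K \<subseteq> D' n) sequentially"
    and P: "\<And>K. compact K \<Longrightarrow> K \<subseteq> ball 0 1 \<Longrightarrow> uniform_limit K P p sequentially"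
    and p: "p holomorphic_on ball 0 1" and D: "open D" "p 0 \<in> D"
  shows "disc_lifting (ball 0 1) p D"
proof -
  have cp: "continuous_on (ball 0 1) p" by (rule holomorphic_on_imp_continuous_on[OF p])
  have lift_scaled: "\<exists>\<phi>. disc_map (ball 0 1) \<phi> \<and> \<phi> 0 = a \<and> (\<forall>t. norm t < 1 \<longrightarrow> p (\<phi> t) = g (of_real \<rho> * t))"
    if a: "norm a < 1" and g: "disc_map D g" "g 0 = p a" and \<rho>: "0 < \<rho>" "\<rho> < 1" for a g \<rho>
  proof -
    have "compact (g ` cball 0 \<rho>)"
    proof (rule compact_continuous_image)
      show "continuous_on (cball 0 \<rho>) g"
        by (rule continuous_on_subset[OF holomorphic_on_imp_continuous_on[OF disc_map_holomorphic[OF g(1)]]])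
          (use \<rho> in auto)
    qed simp
    moreover have "g ` cball 0 \<rho> \<subseteq> D" using \<rho> disc_map_mem[OF g(1)] by auto
    ultimately obtain e where e: "0 < e" "(\<Union>x\<in>g ` cball 0 \<rho>. cball x e) \<subseteq> D"
      using compact_subset_open_imp_cball_epsilon_subset[OF _ D(1)] by metis
    have cK: "compact (\<Union>x\<in>g ` cball 0 \<rho>. cball x e)"
    proof -
      have "(\<Union>x\<in>g ` cball 0 \<rho>. cball x e) = {x + y | x y. x \<in> g ` cball 0 \<rho> \<and> y \<in> cball 0 e}"
        (is "?A = ?B")
      proof
        show "?A \<subseteq> ?B"
        proof
          fix w assume "w \<in> ?A"
          then obtain x where "x \<in> g ` cball 0 \<rho>" "w \<in> cball x e" by blast
          then show "w \<in> ?B"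
            by (intro CollectI exI[of _ x] exI[of _ "w - x"]) (auto simp: dist_norm norm_minus_commute)
        qed
        show "?B \<subseteq> ?A" by (auto simp: dist_norm)
      qed
      then show ?thesis using compact_sums[OF \<open>compact (g ` cball 0 \<rho>)\<close> compact_cball[of 0 e]] by simp
    qed
    have Pa: "(\<lambda>n. P n a) \<longlonglongrightarrow> p a"
      by (rule tendsto_uniform_limitI[OF P[of "{a}"]]) (use a in auto)
    have "eventually (\<lambda>n. (\<Union>x\<in>g ` cball 0 \<rho>. cball x e) \<subseteq> D' n \<and> dist (P n a) (p a) < e) sequentially"
      using D'(2)[OF cK e(2)] tendstoD[OF Pa e(1)] by (rule eventually_conj)
    then obtain N where N: "\<And>n. n \<ge> N \<Longrightarrow> (\<Union>x\<in>g ` cball 0 \<rho>. cball x e) \<subseteq> D' n"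
      "\<And>n. n \<ge> N \<Longrightarrow> dist (P n a) (p a) < e"
      unfolding eventually_sequentially by blast
    \<comment> \<open>The translation makes the disc start at \<open>P (n + N) a\<close> instead of
      \<open>p a\<close>. The margin \<open>e\<close> absorbs it, and it disappears in the
      limit.\<close>
    define G where "G n t = g (of_real \<rho> * t) + (P (n + N) a - p a)" for n t
    have "\<exists>\<phi>. disc_map (\<Omega> (n + N)) \<phi> \<and> \<phi> 0 = a \<and> (\<forall>t. norm t < 1 \<longrightarrow> P (n + N) (\<phi> t) = G n t)" for n
    proof -
      have "disc_map (D' (n + N)) (G n)"
      proof (rule disc_mapI)
        have "disc_map D (\<lambda>t. g (of_real \<rho> * t))" using \<rho> by (intro disc_map_scale[OF g(1)]) simp
        then show "G n holomorphic_on ball 0 1"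
          unfolding G_def by (intro holomorphic_intros disc_map_holomorphic)
        fix t :: complex assume t: "norm t < 1"
        have "norm (of_real \<rho> * t) \<le> \<rho>" using t \<rho> by (simp add: norm_mult mult_left_le)
        then have "g (of_real \<rho> * t) \<in> g ` cball 0 \<rho>" by (intro imageI) simp
        moreover have "G n t \<in> cball (g (of_real \<rho> * t)) e"
          using N(2)[of "n + N"] by (simp add: G_def dist_norm norm_minus_commute)
        ultimately show "G n t \<in> D' (n + N)" using N(1)[of "n + N", OF le_add2] by blast
      qed
      moreover have "G n 0 = P (n + N) a" by (simp add: G_def g(2))
      moreover have "a \<in> \<Omega> (n + N)" using \<Omega>(1)[of "n + N"] a by auto
      ultimately show ?thesis using disc_lifting_lift[OF L] by metis
    qed
    then obtain \<phi> where \<phi>: "\<And>n. disc_map (\<Omega> (n + N)) (\<phi> n)" "\<And>n. \<phi> n 0 = a"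
      "\<And>n t. norm t < 1 \<Longrightarrow> P (n + N) (\<phi> n t) = G n t" by metis
    show ?thesis
    proof (rule disc_lift_limit[of "\<lambda>n. P (n + N)" p a "\<lambda>n. R (n + N)" \<phi> G])
      show "uniform_limit K (\<lambda>n. P (n + N)) p sequentially" if "compact K" "K \<subseteq> ball 0 1" for K
        using filterlim_compose[OF P[OF that] filterlim_subseq[of "\<lambda>n. n + N"]]
        by (simp add: strict_mono_def)
      show "(\<lambda>n. R (n + N)) \<longlonglongrightarrow> 1" using R by (rule LIMSEQ_ignore_initial_segment)
      show "disc_map (ball 0 (R (n + N))) (\<phi> n)" for n using \<phi>(1) \<Omega>(2) disc_map_mono by blast
      have "(\<lambda>n. P (n + N) a) \<longlonglongrightarrow> p a" using Pa by (rule LIMSEQ_ignore_initial_segment)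
      then have "(\<lambda>n. g (of_real \<rho> * t) + (P (n + N) a - p a)) \<longlonglongrightarrow> g (of_real \<rho> * t) + (p a - p a)" for t
        by (intro tendsto_intros)
      then show "(\<lambda>n. G n t) \<longlonglongrightarrow> g (of_real \<rho> * t)" for t by (simp add: G_def)
    qed (use cp a \<phi> in auto)
  qed
  have lift: "\<exists>\<phi>. disc_map (ball 0 1) \<phi> \<and> \<phi> 0 = a \<and> (\<forall>t. norm t < 1 \<longrightarrow> p (\<phi> t) = g t)"
    if a: "norm a < 1" and g: "disc_map D g" "g 0 = p a" for a g
  proof -
    define \<rho> where "\<rho> n = 1 - 1 / (real n + 2)" for n
    have \<rho>: "0 < \<rho> n" "\<rho> n < 1" for n by (auto simp: \<rho>_def field_simps)
    have \<rho>1: "\<rho> \<longlonglongrightarrow> 1"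
      unfolding \<rho>_def[abs_def] by (rule radii_tendsto_1)
    obtain \<phi> where \<phi>: "\<And>n. disc_map (ball 0 1) (\<phi> n)" "\<And>n. \<phi> n 0 = a"
      "\<And>n t. norm t < 1 \<Longrightarrow> p (\<phi> n t) = g (of_real (\<rho> n) * t)"
      using lift_scaled[OF a g \<rho>] by metis
    show ?thesis
    proof (rule disc_lift_limit[of "\<lambda>n. p" p a "\<lambda>n. 1" \<phi> "\<lambda>n t. g (of_real (\<rho> n) * t)"])
      show "uniform_limit K (\<lambda>n. p) p sequentially" for K by (simp add: uniform_limit_const)
      fix t :: complex assume t: "norm t < 1"
      have "isCont g t"
        using holomorphic_on_imp_continuous_on[OF disc_map_holomorphic[OF g(1)]] t
        by (simp add: continuous_on_eq_continuous_at)
      moreover have "(\<lambda>n. of_real (\<rho> n) * t) \<longlonglongrightarrow> of_real 1 * t" by (intro tendsto_intros \<rho>1)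
      ultimately show "(\<lambda>n. g (of_real (\<rho> n) * t)) \<longlonglongrightarrow> g t"
        using isCont_tendsto_compose by fastforce
    qed (use cp a \<phi> in auto)
  qed
  \<comment> \<open>A constant map cannot lift a nonconstant disc; Hurwitz's theorem is applied to
    the nonconstant \<open>p\<close> below.\<close>
  have nonconst: "\<not> p constant_on ball 0 1"
  proof
    assume "p constant_on ball 0 1"
    then obtain c where c: "\<And>z. norm z < 1 \<Longrightarrow> p z = c" by (auto simp: constant_on_def)
    obtain \<rho> where \<rho>: "0 < \<rho>" "ball (p 0) \<rho> \<subseteq> D" using D open_contains_ball by blast
    have "disc_map D (\<lambda>t. p 0 + of_real \<rho> * t)"
    proof (intro disc_mapI holomorphic_intros)
      fix t :: complex assume "norm t < 1"
      then have "p 0 + of_real \<rho> * t \<in> ball (p 0) \<rho>" using \<rho>(1) by (simp add: dist_norm norm_mult)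
      then show "p 0 + of_real \<rho> * t \<in> D" using \<rho>(2) by blast
    qed
    then obtain \<phi> where \<phi>: "disc_map (ball 0 1) \<phi>" "\<And>t. norm t < 1 \<Longrightarrow> p (\<phi> t) = p 0 + of_real \<rho> * t"
      using lift[of 0 "\<lambda>t. p 0 + of_real \<rho> * t"] by auto
    have "p (\<phi> (1/2)) = c" using disc_map_mem[OF \<phi>(1), of "1/2"] c by simp
    then show False using \<phi>(2)[of "1/2"] c[of 0] \<rho>(1) by simp
  qed
  have "p z \<in> D" if z: "norm z < 1" for z
  proof (rule ccontr)
    assume nD: "p z \<notin> D"
    \<comment> \<open>Locally uniform convergence alone could push values of \<open>p\<close> to the
      boundary of \<open>D\<close>. If \<open>p z\<close> were outside \<open>D\<close>, the
      functions \<open>P n t - p z\<close> would be free of zeros, whereas their limit vanishes at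
      \<open>z\<close>.\<close>
    have "p z - p z \<noteq> 0"
    proof (rule Hurwitz_no_zeros[of "ball 0 1" "\<lambda>n t. P n t - p z" "\<lambda>t. p t - p z"])
      show "(\<lambda>t. P n t - p z) holomorphic_on ball 0 1" for n
        by (intro holomorphic_intros holomorphic_on_subset[OF disc_lifting_holomorphic[OF L] \<Omega>(1)])
      show "(\<lambda>t. p t - p z) holomorphic_on ball 0 1" by (intro holomorphic_intros p)
      show "uniform_limit K (\<lambda>n t. P n t - p z) (\<lambda>t. p t - p z) sequentially"
        if "compact K" "K \<subseteq> ball 0 1" for K
        by (intro uniform_limit_intros P that)
      show "\<not> (\<lambda>t. p t - p z) constant_on ball 0 1"
        using nonconst unfolding constant_on_def by (metis diff_add_cancel)
      show "P n t - p z \<noteq> 0" if "t \<in> ball 0 1" for n t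
        using disc_lifting_mem[OF L subsetD[OF \<Omega>(1) that]] D'(1)[of n] nD by fastforce
    qed (use z in auto)
    then show False by simp
  qed
  then show ?thesis using p lift by (intro disc_liftingI) auto
qed

section \<open>Uniformization of open sets omitting two points\<close>

lemma Schottky_bound:
  assumes f: "f holomorphic_on ball 0 1" and w: "w1 \<noteq> w2" "\<And>t. norm t < 1 \<Longrightarrow> f t \<noteq> w1 \<and> f t \<noteq> w2"
    and s: "0 < s" "s < 1" and t: "norm t \<le> s\<^sup>2"
  shows "norm (f t) \<le> norm w1 + norm (w2 - w1) *
    exp (pi * exp (pi * (2 + 2 * norm ((f 0 - w1) / (w2 - w1)) + 12 * s / (1 - s))))"
proof -
  \<comment> \<open>The omitted values become 0 and 1. The rescaling by \<open>s\<close> makes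
    \<open>h\<close> holomorphic on the closed disc; applying the estimate at radius
    \<open>s\<close> then covers radius \<open>s^2\<close> for \<open>f\<close>.\<close>
  define h where "h u = (f (of_real s * u) - w1) / (w2 - w1)" for u
  have ns: "norm (of_real s * u) < 1" if "norm u \<le> 1" for u :: complex
  proof -
    have "norm (of_real s * u) \<le> s" using that s by (simp add: norm_mult mult_left_le)
    then show ?thesis using s by linarith
  qed
  have "(f \<circ> (\<lambda>u. of_real s * u)) holomorphic_on cball 0 1"
    by (rule holomorphic_on_compose_gen[OF _ f]) (auto intro!: holomorphic_intros ns)
  then have hh: "h holomorphic_on cball 0 1"
    unfolding h_def o_def using w(1) by (intro holomorphic_intros) auto
  have "norm (h (t / of_real s)) \<le>
    exp (pi * exp (pi * (2 + 2 * norm ((f 0 - w1) / (w2 - w1)) + 12 * s / (1 - s))))"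
  proof (rule Schottky[OF hh _ _ s])
    show "norm (h 0) \<le> norm ((f 0 - w1) / (w2 - w1))" by (simp add: h_def)
    show "\<not> (h z = 0 \<or> h z = 1)" if "z \<in> cball 0 1" for z
      using w ns[of z] that by (auto simp: h_def)
    show "norm (t / of_real s) \<le> s" using t s by (simp add: norm_divide field_simps power2_eq_square)
  qed
  moreover have "f t = w1 + (w2 - w1) * h (t / of_real s)" using s w(1) by (simp add: h_def)
  then have "norm (f t) \<le> norm w1 + norm (w2 - w1) * norm (h (t / of_real s))"
    using norm_triangle_ineq[of w1 "(w2 - w1) * h (t / of_real s)"] by (simp add: norm_mult)
  ultimately show ?thesis using mult_left_mono[OF _ norm_ge_zero[of "w2 - w1"]] by fastforce
qed

lemma compact_subset_ball_radius:
  assumes "compact K" "K \<subseteq> ball (0::complex) 1"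
  obtains s where "0 < s" "s < (1::real)" "\<And>t. t \<in> K \<Longrightarrow> norm t \<le> s\<^sup>2"
proof (cases "K = {}")
  case True
  then show ?thesis using that[of "1/2"] by auto
next
  case False
  obtain x where x: "x \<in> K" "\<And>t. t \<in> K \<Longrightarrow> norm t \<le> norm x"
    using continuous_attains_sup[OF assms(1) False, of norm] continuous_on_norm_id by blast
  have x1: "norm x < 1" using x assms by auto
  define s where "s = sqrt ((1 + norm x) / 2)"
  have s: "0 < s" "s < 1" "s\<^sup>2 = (1 + norm x) / 2" using x1 by (auto simp: s_def add_pos_nonneg)
  show ?thesis
    by (rule that[OF s(1,2)]) (use x x1 s(3) in fastforce)
qed

text \<open>\<open>D\<close> is exhausted by bounded open sets \<open>D' n\<close>, which may be
  disconnected. Their liftings are defined on sets containing \<open>ball 0 (r n)\<close> with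
  \<open>r n\<close> tending to 1. All of them map 0 to \<open>z\<close> and omit \<open>w1\<close>
  and \<open>w2\<close>, so Schottky's bound makes them a normal family.\<close>

theorem disc_lifting_exists:
  assumes D: "open D" and z: "z \<in> D" and w: "w1 \<noteq> w2" "w1 \<notin> D" "w2 \<notin> D"
  obtains p where "disc_lifting (ball 0 1) p D" "p 0 = z"
proof -
  define D' where "D' n = D \<inter> ball 0 (real n + 1 + norm z)" for n
  define r where "r n = 1 - 1 / (real n + 2)" for n
  have r: "0 < r n" "r n < 1" for n by (auto simp: r_def field_simps)
  have r1: "r \<longlonglongrightarrow> 1"
    unfolding r_def[abs_def] by (rule radii_tendsto_1)
  have D'1: "open (D' n)" "bounded (D' n)" "z \<in> D' n" "D' n \<subseteq> D" for n
    using D z by (auto simp: D'_def bounded_Int open_Int)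
  have "\<exists>\<Omega> p. disc_lifting \<Omega> p (D' n) \<and> ball 0 (r n) \<subseteq> \<Omega> \<and> \<Omega> \<subseteq> ball 0 1 \<and> p 0 = z" for n
    using bounded_disc_lifting_exists[OF D'1(1,2,3) r] by metis
  then obtain \<Omega> p where \<Omega>: "\<And>n. disc_lifting (\<Omega> n) (p n) (D' n)" "\<And>n. ball 0 (r n) \<subseteq> \<Omega> n"
    "\<And>n. \<Omega> n \<subseteq> ball 0 1" "\<And>n. p n 0 = z" by metis
  \<comment> \<open>Stretching by \<open>1 / r n\<close> puts all maps on a common domain containing
    the unit disc. The summand 0 only matches the form of
    \<open>disc_lifting_affine\<close>.\<close>
  define \<Omega>' where "\<Omega>' n = {u. 0 + of_real (r n) * u \<in> \<Omega> n}" for n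
  define P where "P n u = p n (0 + of_real (r n) * u)" for n u
  have L: "disc_lifting (\<Omega>' n) (P n) (D' n)" for n
    unfolding \<Omega>'_def P_def using r[of n]
    by (intro disc_lifting_compose[OF \<Omega>(1) disc_lifting_affine[OF disc_lifting_open[OF \<Omega>(1)]]]) auto
  have \<Omega>'1: "ball 0 1 \<subseteq> \<Omega>' n" for n
  proof
    fix u :: complex assume "u \<in> ball 0 1"
    then have "of_real (r n) * u \<in> ball 0 (r n)" using r[of n] by (simp add: norm_mult)
    then show "u \<in> \<Omega>' n" using \<Omega>(2)[of n] by (auto simp: \<Omega>'_def)
  qed
  have \<Omega>'2: "\<Omega>' n \<subseteq> ball 0 (1 / r n)" for n
  proof
    fix u :: complex assume "u \<in> \<Omega>' n"
    then have "of_real (r n) * u \<in> ball 0 1" using \<Omega>(3)[of n] by (auto simp: \<Omega>'_def)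
    then show "u \<in> ball 0 (1 / r n)" using r[of n] by (simp add: norm_mult field_simps)
  qed
  have P1: "P n holomorphic_on ball 0 1" "P n t \<in> D" if "norm t < 1" for n t
    using holomorphic_on_subset[OF disc_lifting_holomorphic[OF L] \<Omega>'1]
      disc_lifting_mem[OF L, of t n] \<Omega>'1 D'1(4)[of n] that by (auto simp: subset_iff)
  have P0: "P n 0 = z" for n by (simp add: P_def \<Omega>(4))
  have Pw: "P n t \<noteq> w1 \<and> P n t \<noteq> w2" if "norm t < 1" for n t
    using P1(2)[OF that, of n] w by auto
  obtain q k where q: "q holomorphic_on ball 0 1" and k: "strict_mono (k :: nat \<Rightarrow> nat)"
    and lim: "\<And>x. x \<in> ball 0 1 \<Longrightarrow> (\<lambda>n. P (k n) x) \<longlonglongrightarrow> q x"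
    and ul: "\<And>K. compact K \<Longrightarrow> K \<subseteq> ball 0 1 \<Longrightarrow> uniform_limit K (P \<circ> k) q sequentially"
  proof (rule Montel[of "ball 0 1" "range P" P])
    show "h holomorphic_on ball 0 1" if "h \<in> range P" for h
      using that P1(1)[of 0] by auto
    show "\<exists>B. \<forall>h\<in>range P. \<forall>z\<in>K. norm (h z) \<le> B" if K: "compact K" "K \<subseteq> ball 0 1" for K
    proof -
      obtain s where s: "0 < s" "s < (1::real)" "\<And>t. t \<in> K \<Longrightarrow> norm t \<le> s\<^sup>2"
        using compact_subset_ball_radius[OF K] by blast
      have "norm (P n t) \<le> norm w1 + norm (w2 - w1) *
        exp (pi * exp (pi * (2 + 2 * norm ((z - w1) / (w2 - w1)) + 12 * s / (1 - s))))" if "t \<in> K" for n t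
        using Schottky_bound[OF P1(1)[of 0 n] w(1) Pw[of _ n] s(1,2) s(3)[OF that]] by (simp add: P0)
      then show ?thesis by blast
    qed
  qed auto
  have q0: "q 0 = z" using lim[of 0] by (simp add: P0 LIMSEQ_const_iff)
  have "disc_lifting (ball 0 1) q D"
  proof (rule disc_lifting_limit[of "\<lambda>n. \<Omega>' (k n)" "\<lambda>n. P (k n)" "\<lambda>n. D' (k n)" "\<lambda>n. 1 / r (k n)"])
    have "(\<lambda>n. r (k n)) \<longlonglongrightarrow> 1" using LIMSEQ_subseq_LIMSEQ[OF r1 k] by (simp add: o_def)
    from tendsto_divide[OF tendsto_const this, of 1] show "(\<lambda>n. 1 / r (k n)) \<longlonglongrightarrow> 1" by simp
    show "uniform_limit K (\<lambda>n. P (k n)) q sequentially" if "compact K" "K \<subseteq> ball 0 1" for K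
      using ul[OF that] by (simp add: o_def)
    show "eventually (\<lambda>n. K \<subseteq> D' (k n)) sequentially" if K: "compact K" "K \<subseteq> D" for K
    proof -
      obtain B where B: "\<And>x. x \<in> K \<Longrightarrow> norm x \<le> B"
        using compact_imp_bounded[OF K(1)] unfolding bounded_iff by blast
      obtain N where N: "B \<le> real N" using real_arch_simple by blast
      have "K \<subseteq> D' (k n)" if "n \<ge> N" for n
      proof
        fix x assume x: "x \<in> K"
        have "N \<le> k n" using that seq_suble[OF k, of n] by simp
        then have "norm x \<le> real (k n)" using B[OF x] N by linarith
        then have "norm x < real (k n) + 1 + norm z" using norm_ge_zero[of z] by linarith
        then show "x \<in> D' (k n)" using K(2) x by (auto simp: D'_def)
      qed
      then show ?thesis unfolding eventually_sequentially by blast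
    qed
  qed (use L \<Omega>'1 \<Omega>'2 D'1 q D q0 z in auto)
  then show thesis using q0 that by blast
qed

section \<open>Automorphisms of the disc\<close>

text \<open>All automorphisms of the disc have this form, with \<open>norm B < norm A\<close>.\<close>

definition mob :: "complex \<Rightarrow> complex \<Rightarrow> complex \<Rightarrow> complex" where
  "mob A B z = (A * z + B) / (cnj B * z + cnj A)"

lemma mob_denom_nonzero:
  assumes "norm B < norm A" "norm z \<le> 1"
  shows "cnj B * z + cnj A \<noteq> 0"
proof
  assume "cnj B * z + cnj A = 0"
  then have "cnj A = - (cnj B * z)" by (simp add: eq_neg_iff_add_eq_0 add.commute)
  then have "norm A = norm B * norm z" by (metis complex_mod_cnj norm_minus_cancel norm_mult)
  also have "\<dots> \<le> norm B" using assms(2) by (simp add: mult_left_le)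
  finally show False using assms(1) by simp
qed

text \<open>The matrix with rows \<open>(A, B)\<close> and \<open>(cnj B, cnj A)\<close> multiplies
  the Hermitian form \<open>|y|^2 - |x|^2\<close> by its determinant \<open>|A|^2 - |B|^2\<close>;
  this is the case of the vector \<open>(z, 1)\<close>.\<close>

lemma norm_square_diff:
  "(norm (cnj B * z + cnj A))\<^sup>2 - (norm (A * z + B))\<^sup>2 = ((norm A)\<^sup>2 - (norm B)\<^sup>2) * (1 - (norm z)\<^sup>2)"
proof -
  have "complex_of_real ((norm (cnj B * z + cnj A))\<^sup>2 - (norm (A * z + B))\<^sup>2) =
    of_real (((norm A)\<^sup>2 - (norm B)\<^sup>2) * (1 - (norm z)\<^sup>2))"
    unfolding of_real_diff of_real_mult complex_norm_square of_real_1
    by (simp add: algebra_simps)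
  then show ?thesis using of_real_eq_iff by blast
qed

lemma norm_mob_less_1:
  assumes "norm B < norm A" "norm z < 1"
  shows "norm (mob A B z) < 1"
proof -
  have "0 < ((norm A)\<^sup>2 - (norm B)\<^sup>2) * (1 - (norm z)\<^sup>2)"
    using assms by (intro mult_pos_pos) (auto simp: power_strict_mono abs_square_less_1)
  then have "(norm (A * z + B))\<^sup>2 < (norm (cnj B * z + cnj A))\<^sup>2"
    unfolding norm_square_diff[symmetric] by simp
  then have "norm (A * z + B) < norm (cnj B * z + cnj A)"
    by (rule power_less_imp_less_base) simp
  then show ?thesis by (auto simp: mob_def norm_divide divide_less_eq_1)
qed

lemma disc_map_mob:
  assumes "norm B < norm A"
  shows "disc_map (ball 0 1) (mob A B)"
  unfolding mob_def[abs_def] using mob_denom_nonzero[OF assms] norm_mob_less_1[OF assms]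
  by (intro disc_mapI holomorphic_intros) (auto simp: mob_def)

lemma disc_map_mob_compose:
  assumes "disc_map D f" "norm B < norm A"
  shows "disc_map D (\<lambda>t. f (mob A B t))"
  by (rule disc_map_compose[OF disc_map_mob[OF assms(2)]]) (use assms(1) in \<open>auto simp: disc_map_def\<close>)

lemma mob_0: "mob A B 0 = B / cnj A"
  by (simp add: mob_def)

lemma deriv_mob_0:
  assumes "norm B < norm A"
  shows "(mob A B has_field_derivative (A * cnj A - B * cnj B) / (cnj A)\<^sup>2) (at 0)"
proof -
  have "A \<noteq> 0" using assms by auto
  then show ?thesis
    unfolding mob_def[abs_def] by (auto intro!: derivative_eq_intros simp: power2_eq_square algebra_simps)
qed

text \<open>Composition is multiplication of the matrices with rows \<open>(A, B)\<close> and
  \<open>(cnj B, cnj A)\<close>.\<close>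

lemma mob_compose:
  assumes "norm B < norm A" "norm B' < norm A'" "norm z < 1"
  shows "mob A B (mob A' B' z) = mob (A * A' + B * cnj B') (A * B' + B * cnj A') z"
proof -
  define d where "d = cnj B' * z + cnj A'"
  have d: "d \<noteq> 0" using mob_denom_nonzero[OF assms(2)] assms(3) by (simp add: d_def)
  have m: "mob A' B' z = (A' * z + B') / d" by (simp add: mob_def d_def)
  have 1: "A * ((A' * z + B') / d) + B = (A * (A' * z + B') + B * d) / d" using d by (simp add: field_simps)
  have 2: "cnj B * ((A' * z + B') / d) + cnj A = (cnj B * (A' * z + B') + cnj A * d) / d"
    using d by (simp add: field_simps)
  have "mob A B (mob A' B' z) = (A * (A' * z + B') + B * d) / (cnj B * (A' * z + B') + cnj A * d)"
    unfolding m unfolding mob_def[of A B] 1 2 using d by simp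
  also have "\<dots> = mob (A * A' + B * cnj B') (A * B' + B * cnj A') z"
    unfolding mob_def d_def by (simp add: algebra_simps)
  finally show ?thesis .
qed

lemma mob_inverse:
  assumes "norm B < norm A" "norm z < 1"
  shows "mob (cnj A) (- B) (mob A B z) = z"
proof -
  have "A * cnj A - B * cnj B = of_real ((norm A)\<^sup>2 - (norm B)\<^sup>2)"
    unfolding of_real_diff complex_norm_square ..
  moreover have "(norm A)\<^sup>2 - (norm B)\<^sup>2 \<noteq> 0" using assms(1) power_strict_mono[of "norm B" "norm A" 2] by simp
  ultimately have nz: "A * cnj A - B * cnj B \<noteq> 0" by (simp only: of_real_eq_0_iff not_False_eq_True)
  have "mob (cnj A) (- B) (mob A B z) = mob (A * cnj A - B * cnj B) 0 z"
    using mob_compose[of "- B" "cnj A" B A z] assms by (simp add: mult.commute)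
  also have "\<dots> = z" using nz by (simp add: mob_def mult.commute)
  finally show ?thesis .
qed

text \<open>After moving \<open>\<psi> 0\<close> to 0, the Schwarz lemma for the map and for its
  left inverse forces equality of norms, so the map is a rotation. A left inverse suffices for
  this.\<close>

lemma disc_automorphism_eq_mob:
  assumes \<psi>: "disc_map (ball 0 1) \<psi>" and \<eta>: "disc_map (ball 0 1) \<eta>" and inv: "\<And>z. norm z < 1 \<Longrightarrow> \<eta> (\<psi> z) = z"
  obtains A B where "norm B < norm A" "\<And>z. norm z < 1 \<Longrightarrow> \<psi> z = mob A B z"
proof -
  define c where "c = \<psi> 0"
  have c: "norm c < norm (1::complex)" using disc_map_mem[OF \<psi>, of 0] by (simp add: c_def)
  define \<phi> where "\<phi> z = mob 1 (- c) (\<psi> z)" for z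
  have \<psi>1: "norm (\<psi> z) < 1" if "norm z < 1" for z using disc_map_mem[OF \<psi> that] by simp
  have mc: "mob 1 c (mob 1 (- c) z) = z" if "norm z < 1" for z
    using mob_inverse[of "- c" 1 z] c that by simp
  have \<phi>: "disc_map (ball 0 1) \<phi>"
    unfolding \<phi>_def using c disc_map_mob[of "- c" 1]
    by (intro disc_map_compose[OF \<psi>]) (auto simp: disc_map_def)
  have \<phi>0: "\<phi> 0 = 0" by (simp add: \<phi>_def c_def mob_def)
  have \<phi>1: "norm (\<phi> z) < 1" if "norm z < 1" for z using disc_map_mem[OF \<phi> that] by simp
  have \<eta>': "disc_map (ball 0 1) (\<lambda>z. \<eta> (mob 1 c z))" by (rule disc_map_mob_compose[OF \<eta> c])
  have \<eta>0: "\<eta> (mob 1 c 0) = 0" using inv[of 0] by (simp add: mob_0 c_def)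
  have ge: "norm z \<le> norm (\<phi> z)" if z: "norm z < 1" for z
  proof -
    have "norm (\<eta> (mob 1 c (\<phi> z))) \<le> norm (\<phi> z)"
      by (rule Schwarz_Lemma(1)[of "\<lambda>z. \<eta> (mob 1 c z)"])
        (use \<eta>' \<eta>0 \<phi>1[OF z] disc_map_mem[OF \<eta>'] disc_map_holomorphic in auto)
    also have "\<eta> (mob 1 c (\<phi> z)) = z" unfolding \<phi>_def mc[OF \<psi>1[OF z]] by (rule inv[OF z])
    finally show ?thesis .
  qed
  have le: "norm (\<phi> z) \<le> norm z" if "norm z < 1" for z
    by (rule Schwarz_Lemma(1)[OF disc_map_holomorphic[OF \<phi>] \<phi>0 \<phi>1 that])
  have "norm (\<phi> (1/2)) = norm (1/2::complex)" by (intro antisym ge le) auto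
  then have "\<exists>z. norm z < 1 \<and> z \<noteq> 0 \<and> norm (\<phi> z) = norm z" by (intro exI[of _ "1/2"]) auto
  then obtain \<alpha> where \<alpha>: "\<And>z. norm z < 1 \<Longrightarrow> \<phi> z = \<alpha> * z" "norm \<alpha> = 1"
    using Schwarz_Lemma(3)[OF disc_map_holomorphic[OF \<phi>] \<phi>0 \<phi>1, of 0] by auto
  \<comment> \<open>Numerator and denominator of \<open>mob\<close> carry conjugate coefficients, so
    the rotation by \<open>\<alpha>\<close> is \<open>mob \<mu> 0\<close> with \<open>\<mu>\<close>
    a square root of \<open>\<alpha>\<close>.\<close>
  define \<mu> where "\<mu> = csqrt \<alpha>"
  have \<mu>2: "\<mu> * \<mu> = \<alpha>" by (simp add: \<mu>_def flip: power2_eq_square)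
  have \<mu>1: "norm \<mu> = 1" using \<alpha>(2) by (simp add: \<mu>_def)
  then have \<mu>c: "\<mu> * cnj \<mu> = 1" by (simp add: complex_norm_square[symmetric])
  have "\<psi> z = mob \<mu> (c * cnj \<mu>) z" if z: "norm z < 1" for z
  proof -
    have "\<psi> z = mob 1 c (\<phi> z)" unfolding \<phi>_def using mc[OF \<psi>1[OF z]] by simp
    also have "\<dots> = mob 1 c (\<alpha> * z)" using \<alpha>(1)[OF z] by simp
    also have "\<dots> = (\<mu> * (\<mu> * z + c * cnj \<mu>)) / (\<mu> * (cnj (c * cnj \<mu>) * z + cnj \<mu>))"
    proof -
      have "\<mu> * (\<mu> * z + c * cnj \<mu>) = \<alpha> * z + c * (\<mu> * cnj \<mu>)" by (simp add: algebra_simps flip: \<mu>2)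
      moreover have "\<mu> * (cnj (c * cnj \<mu>) * z + cnj \<mu>) = cnj c * (\<alpha> * z) + \<mu> * cnj \<mu>"
        by (simp add: algebra_simps flip: \<mu>2)
      ultimately show ?thesis by (simp add: mob_def \<mu>c)
    qed
    also have "\<dots> = mob \<mu> (c * cnj \<mu>) z" using \<mu>1 by (auto simp: mob_def)
    finally show ?thesis .
  qed
  moreover have "norm (c * cnj \<mu>) < norm \<mu>" using c \<mu>1 by (simp add: norm_mult)
  ultimately show thesis using that by blast
qed

text \<open>\<open>2 * Re A\<close> is the trace of the matrix; trace 0 characterises half-turns,
  which fix a point of the disc.\<close>

lemma mob_fixpoint_free_Re:
  assumes lt: "norm B < norm A" and fp: "\<And>z. norm z < 1 \<Longrightarrow> mob A B z \<noteq> z"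
  shows "Re A \<noteq> 0"
proof
  assume Re0: "Re A = 0"
  define y where "y = Im A"
  have A: "A = \<i> * of_real y" by (simp add: complex_eq_iff Re0 y_def)
  have nA: "norm A = \<bar>y\<bar>" by (simp add: A norm_mult)
  define k where "k = sqrt (y\<^sup>2 - (norm B)\<^sup>2)"
  have "(norm B)\<^sup>2 < y\<^sup>2" using lt nA power_strict_mono[of "norm B" "\<bar>y\<bar>" 2] by simp
  then have k: "0 < k" "k\<^sup>2 = y\<^sup>2 - (norm B)\<^sup>2" by (auto simp: k_def)
  have y0: "y \<noteq> 0" using lt nA by auto
  \<comment> \<open>With \<open>z = \<i> * B / Y\<close> the fixed point equation becomes
    \<open>Y^2 - 2 y Y + |B|^2 = 0\<close>. The root of larger modulus exceeds
    \<open>norm B\<close>, which puts \<open>z\<close> inside the disc.\<close>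
  define Y where "Y = y + sgn y * k"
  have "\<bar>Y\<bar> = \<bar>y\<bar> + k" using k(1) y0 by (auto simp: Y_def sgn_if abs_if)
  then have Y: "norm B < \<bar>Y\<bar>" using lt nA k(1) by linarith
  have s2: "(sgn y)\<^sup>2 = 1" "sgn y * sgn y = 1" using y0 by (auto simp: sgn_if)
  have "Y\<^sup>2 - 2 * y * Y + (norm B)\<^sup>2 = (sgn y)\<^sup>2 * k\<^sup>2 - y\<^sup>2 + (norm B)\<^sup>2"
    by (simp add: Y_def power2_eq_square algebra_simps)
  also have "\<dots> = 0" by (simp add: s2 k(2))
  finally have "of_real (Y\<^sup>2 - 2 * y * Y + (norm B)\<^sup>2) = (0::complex)" by simp
  then have q: "of_real Y * of_real Y - 2 * of_real y * of_real Y + B * cnj B = 0"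
    unfolding of_real_add of_real_diff complex_norm_square by (simp add: power2_eq_square)
  define z where "z = \<i> * B / of_real Y"
  have Y0: "Y \<noteq> 0" using Y by auto
  have z1: "norm z < 1" using Y Y0 by (simp add: z_def norm_divide norm_mult)
  have "(A * z + B) - z * (cnj B * z + cnj A) = B / (of_real Y)\<^sup>2 *
      (of_real Y * of_real Y - 2 * of_real y * of_real Y + B * cnj B)"
    using Y0 by (simp add: A z_def field_simps power2_eq_square)
  then have "A * z + B = z * (cnj B * z + cnj A)" unfolding q by simp
  then have "mob A B z = z"
    using mob_denom_nonzero[OF lt, of z] z1 by (simp add: mob_def)
  then show False using fp[OF z1] by simp
qed

text \<open>Conjugating by the automorphism \<open>mob 1 s\<close>, with \<open>s\<close> running along a radius that ends at a
  boundary point not fixed by \<open>mob A B\<close>, makes the displacement of the origin take every value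
  close to \<open>1\<close>.\<close>

lemma mob_conjugate_displacement:
  assumes lt: "norm B < norm A" and fp: "\<And>z. norm z < 1 \<Longrightarrow> mob A B z \<noteq> z"
    and \<delta>: "norm B / norm A < \<delta>" "\<delta> < 1"
  obtains s A' B' where "norm s < 1" "norm B' = \<delta> * norm A'" "Re A' \<noteq> 0" "Im A' \<noteq> 0"
    "\<forall>z. norm z < 1 \<longrightarrow> mob 1 (- s) (mob A B (mob 1 s z)) = mob A' B' z"
proof -
  have Re: "Re A \<noteq> 0" by (rule mob_fixpoint_free_Re[OF lt fp])
  have B0: "B \<noteq> 0" using fp[of 0] by (auto simp: mob_0)
  \<comment> \<open>\<open>\<zeta>\<close> makes \<open>cnj \<zeta> * B\<close> imaginary with a
    sign agreeing with that of \<open>Im A\<close>. The two contributions to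
    \<open>Im (a (r * \<zeta>))\<close> then cannot cancel, so it is nonzero for all
    \<open>r > 0\<close>, including the boundary value \<open>r = 1\<close>.\<close>
  define \<sigma> :: real where "\<sigma> = (if 0 \<le> Im A then 1 else - 1)"
  define \<zeta> where "\<zeta> = - \<i> * of_real \<sigma> * B / of_real (norm B)"
  have \<zeta>1: "norm \<zeta> = 1" using B0 by (simp add: \<zeta>_def norm_mult norm_divide \<sigma>_def)
  have "B * cnj B = of_real (norm B) * of_real (norm B)"
    by (metis complex_norm_square of_real_mult power2_eq_square)
  then have \<zeta>B: "cnj \<zeta> * B = \<i> * of_real (\<sigma> * norm B)"
    using B0 by (simp add: \<zeta>_def field_simps)
  then have \<zeta>B': "\<zeta> * cnj B = - \<i> * of_real (\<sigma> * norm B)"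
    by (metis complex_cnj_cnj complex_cnj_complex_of_real complex_cnj_i complex_cnj_mult)
  \<comment> \<open>The parameters of the conjugated map, read off from the matrix product. They
    make sense also for \<open>norm s = 1\<close>, where \<open>mob 1 s\<close> degenerates; there
    \<open>det\<close> forces \<open>norm (a s) = norm (b s)\<close>, that is, displacement
    1.\<close>
  define a where "a s = A - s * cnj B + cnj s * B - s * cnj s * cnj A" for s
  define b where "b s = B + s * A - s * cnj A - s * s * cnj B" for s
  have det: "(norm (a s))\<^sup>2 - (norm (b s))\<^sup>2 = (1 - (norm s)\<^sup>2) * (1 - (norm s)\<^sup>2) * ((norm A)\<^sup>2 - (norm B)\<^sup>2)" for s
  proof -
    have "complex_of_real ((norm (a s))\<^sup>2 - (norm (b s))\<^sup>2) =
        of_real ((1 - (norm s)\<^sup>2) * (1 - (norm s)\<^sup>2) * ((norm A)\<^sup>2 - (norm B)\<^sup>2))"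
      unfolding of_real_diff of_real_mult complex_norm_square of_real_1
      by (simp add: a_def b_def algebra_simps)
    then show ?thesis using of_real_eq_iff by blast
  qed
  have ar: "a (of_real r * \<zeta>) = A - of_real (r\<^sup>2) * cnj A + \<i> * of_real (2 * r * \<sigma> * norm B)" for r
  proof -
    have "a (of_real r * \<zeta>) = A - of_real r * (\<zeta> * cnj B) + of_real r * (cnj \<zeta> * B)
        - of_real (r\<^sup>2) * (\<zeta> * cnj \<zeta>) * cnj A"
      by (simp add: a_def power2_eq_square algebra_simps)
    also have "\<zeta> * cnj \<zeta> = 1" using \<zeta>1 by (simp add: complex_norm_square[symmetric])
    finally show ?thesis unfolding \<zeta>B \<zeta>B' by (simp add: algebra_simps)
  qed
  have Re_a: "Re (a (of_real r * \<zeta>)) = (1 - r\<^sup>2) * Re A" for r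
    unfolding ar by (simp add: algebra_simps)
  have Im_a: "Im (a (of_real r * \<zeta>)) = (1 + r\<^sup>2) * Im A + 2 * r * \<sigma> * norm B" for r
    unfolding ar by (simp add: algebra_simps)
  have Im_nz: "Im (a (of_real r * \<zeta>)) \<noteq> 0" if "0 < r" for r
  proof -
    have "\<sigma> * Im (a (of_real r * \<zeta>)) = (1 + r\<^sup>2) * \<bar>Im A\<bar> + 2 * r * norm B"
      unfolding Im_a by (auto simp: \<sigma>_def algebra_simps)
    also have "\<dots> > 0" using that B0 by (intro add_nonneg_pos) auto
    finally show ?thesis by auto
  qed
  define N where "N r = norm (b (of_real r * \<zeta>)) / norm (a (of_real r * \<zeta>))" for r
  have a_nz: "a (of_real r * \<zeta>) \<noteq> 0" if "0 \<le> r" for r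
  proof (cases "r = 0")
    case True
    then show ?thesis using Re by (auto simp: a_def)
  next
    case False
    then show ?thesis using Im_nz[of r] that by auto
  qed
  have N0: "N 0 = norm B / norm A" by (simp add: N_def a_def b_def)
  have N1: "N 1 = 1"
  proof -
    have "(norm (a \<zeta>))\<^sup>2 = (norm (b \<zeta>))\<^sup>2" using det[of \<zeta>] \<zeta>1 by simp
    then have "norm (a \<zeta>) = norm (b \<zeta>)" by simp
    then show ?thesis using a_nz[of 1] by (auto simp: N_def)
  qed
  have "continuous_on {0..1} N"
    unfolding N_def
    by (intro continuous_intros) (use a_nz in \<open>auto simp: a_def b_def intro!: continuous_intros\<close>)
  then obtain r where r: "0 \<le> r" "r \<le> 1" "N r = \<delta>"
    using IVT'[of N 0 \<delta> 1] \<delta> N0 N1 by auto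
  then have r': "0 < r" "r < 1" using \<delta> N0 N1 by (auto simp: less_le)
  define s where "s = of_real r * \<zeta>"
  have s1: "norm s < 1" using r' \<zeta>1 by (simp add: s_def norm_mult)
  show thesis
  proof
    show "norm s < 1" by (rule s1)
    show "norm (b s) = \<delta> * norm (a s)" using r(3) a_nz[OF r(1)] by (auto simp: N_def s_def)
    have "r\<^sup>2 \<noteq> 1" using r' by (simp add: power2_eq_1_iff)
    then show "Re (a s) \<noteq> 0" using Re Re_a[of r] by (simp add: s_def)
    show "Im (a s) \<noteq> 0" using Im_nz r' by (simp add: s_def)
    have s1': "norm s < norm (1::complex)" "norm (- s) < norm (1::complex)" using s1 by auto
    have det2: "norm (A * s + B) < norm (A + B * cnj s)"
    proof -
      have "0 < ((norm A)\<^sup>2 - (norm B)\<^sup>2) * (1 - (norm s)\<^sup>2)"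
        using lt s1 by (intro mult_pos_pos) (auto simp: power_strict_mono abs_square_less_1)
      then have "(norm (A * s + B))\<^sup>2 < (norm (cnj B * s + cnj A))\<^sup>2"
        unfolding norm_square_diff[symmetric] by simp
      also have "norm (cnj B * s + cnj A) = norm (cnj (A + B * cnj s))" by (simp add: add.commute)
      finally show ?thesis unfolding complex_mod_cnj by (rule power_less_imp_less_base) simp
    qed
    have "mob 1 (- s) (mob A B (mob 1 s z)) = mob (a s) (b s) z" if z: "norm z < 1" for z
    proof -
      have "mob A B (mob 1 s z) = mob (A + B * cnj s) (A * s + B) z"
        using mob_compose[OF lt s1'(1) z] by simp
      then have "mob 1 (- s) (mob A B (mob 1 s z)) = mob 1 (- s) (mob (A + B * cnj s) (A * s + B) z)" by simp
      also have "\<dots> = mob (a s) (b s) z"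
        unfolding mob_compose[OF s1'(2) det2 z] by (simp add: a_def b_def algebra_simps)
      finally show ?thesis .
    qed
    then show "\<forall>z. norm z < 1 \<longrightarrow> mob 1 (- s) (mob A B (mob 1 s z)) = mob (a s) (b s) z" by blast
  qed
qed

section \<open>Deck transformations\<close>

text \<open>An affine disc about \<open>p a\<close> lifts, and the chain rule writes its nonzero
  derivative as a multiple of \<open>deriv p a\<close>.\<close>

lemma disc_lifting_deriv_nonzero:
  assumes p: "disc_lifting \<Omega> p D" and D: "open D" and a: "a \<in> \<Omega>"
  shows "deriv p a \<noteq> 0"
proof
  assume 0: "deriv p a = 0"
  obtain \<rho> where \<rho>: "0 < \<rho>" "ball (p a) \<rho> \<subseteq> D"
    using D disc_lifting_mem[OF p a] open_contains_ball by blast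
  define g where "g t = p a + of_real \<rho> * t" for t
  have "disc_map D g"
    unfolding g_def
  proof (intro disc_mapI holomorphic_intros)
    fix t :: complex assume "norm t < 1"
    then have "p a + of_real \<rho> * t \<in> ball (p a) \<rho>" using \<rho>(1) by (simp add: dist_norm norm_mult)
    then show "p a + of_real \<rho> * t \<in> D" using \<rho>(2) by blast
  qed
  then obtain \<phi> where \<phi>: "disc_map \<Omega> \<phi>" "\<phi> 0 = a" "\<And>t. norm t < 1 \<Longrightarrow> p (\<phi> t) = g t"
    using disc_lifting_lift[OF p a, of g] by (auto simp: g_def)
  have "(p has_field_derivative deriv p a) (at (\<phi> 0))"
    using holomorphic_derivI[OF disc_lifting_holomorphic[OF p] disc_lifting_open[OF p] a] \<phi>(2) by simp
  then have "((\<lambda>t. p (\<phi> t)) has_field_derivative deriv p a * deriv \<phi> 0) (at 0)"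
    using disc_map_has_derivative[OF \<phi>(1)] DERIV_chain2 by blast
  then have "(g has_field_derivative deriv p a * deriv \<phi> 0) (at 0)"
    by (rule has_field_derivative_transform_within_open[of _ _ _ "ball 0 1"]) (use \<phi>(3) in auto)
  moreover have "(g has_field_derivative of_real \<rho>) (at 0)"
    unfolding g_def by (auto intro!: derivative_eq_intros)
  ultimately have "deriv p a * deriv \<phi> 0 = of_real \<rho>" by (rule DERIV_unique)
  then show False using 0 \<rho>(1) by simp
qed

text \<open>Near a fixed point \<open>p\<close> is injective, so \<open>p (\<psi> z) = p z\<close>
  forces \<open>\<psi> z = z\<close> there; analytic continuation does the rest.\<close>

lemma deck_fixpoint_imp_id:
  assumes p: "disc_lifting (ball 0 1) p D" and D: "open D"
    and \<psi>: "disc_map (ball 0 1) \<psi>" "\<And>z. norm z < 1 \<Longrightarrow> p (\<psi> z) = p z"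
    and c: "norm c < 1" "\<psi> c = c" and z: "norm z < 1"
  shows "\<psi> z = z"
proof -
  obtain r where r: "0 < r" "ball c r \<subseteq> ball 0 1" "inj_on p (ball c r)"
    using has_complex_derivative_locally_injective[OF disc_lifting_holomorphic[OF p] _ _
        disc_lifting_deriv_nonzero[OF p D]] c(1) by auto
  have "open (ball 0 1 \<inter> \<psi> -` ball c r)"
    by (rule continuous_open_preimage[OF holomorphic_on_imp_continuous_on[OF disc_map_holomorphic[OF \<psi>(1)]]]) auto
  then have op: "open (ball c r \<inter> (ball 0 1 \<inter> \<psi> -` ball c r))" by auto
  show ?thesis
  proof (rule analytic_continuation_open[OF op open_ball, of 0 1 \<psi> "\<lambda>z. z"])
    have "c \<in> ball c r \<inter> (ball 0 1 \<inter> \<psi> -` ball c r)" using c r(1) by simp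
    then show "ball c r \<inter> (ball 0 1 \<inter> \<psi> -` ball c r) \<noteq> {}" by blast
    show "\<psi> w = w" if "w \<in> ball c r \<inter> (ball 0 1 \<inter> \<psi> -` ball c r)" for w
      using inj_onD[OF r(3), of "\<psi> w" w] \<psi>(2)[of w] that by auto
  qed (use z disc_map_holomorphic[OF \<psi>(1)] in auto)
qed

text \<open>Lifts are based at 0, so \<open>p\<close> is recentred at \<open>a\<close> by an
  automorphism, lifted through itself with starting point \<open>b\<close>, and the recentring is
  undone.\<close>

lemma deck_exists:
  assumes p: "disc_lifting (ball 0 1) p D" and D: "open D"
    and ab: "norm a < 1" "norm b < 1" "p a = p b"
  obtains \<psi> where "disc_map (ball 0 1) \<psi>" "\<And>z. norm z < 1 \<Longrightarrow> p (\<psi> z) = p z" "\<psi> a = b"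
proof -
  have pd: "disc_map D p" using disc_lifting_holomorphic[OF p] disc_lifting_mem[OF p] by (auto intro!: disc_mapI)
  have a1: "norm a < norm (1::complex)" "norm (- a) < norm (1::complex)" using ab by auto
  have "disc_map D (\<lambda>t. p (mob 1 a t))" by (rule disc_map_mob_compose[OF pd a1(1)])
  moreover have "p (mob 1 a 0) = p b" using ab by (simp add: mob_0)
  ultimately obtain \<phi> where \<phi>: "disc_map (ball 0 1) \<phi>" "\<phi> 0 = b" "\<And>t. norm t < 1 \<Longrightarrow> p (\<phi> t) = p (mob 1 a t)"
    using disc_lifting_lift[OF p, of b "\<lambda>t. p (mob 1 a t)"] ab by auto
  show thesis
  proof
    show "disc_map (ball 0 1) (\<lambda>z. \<phi> (mob 1 (- a) z))" by (rule disc_map_mob_compose[OF \<phi>(1) a1(2)])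
    show "\<phi> (mob 1 (- a) a) = b" using \<phi>(2) by (simp add: mob_def)
    fix z :: complex assume z: "norm z < 1"
    show "p (\<phi> (mob 1 (- a) z)) = p z"
      using \<phi>(3)[OF norm_mob_less_1[OF a1(2) z]] mob_inverse[OF a1(2) z] by simp
  qed
qed

definition deck :: "(complex \<Rightarrow> complex) \<Rightarrow> complex \<Rightarrow> complex \<Rightarrow> bool" where
  "deck p A B \<longleftrightarrow> norm B < norm A \<and> (\<forall>z. norm z < 1 \<longrightarrow> p (mob A B z) = p z)"

text \<open>The lifts taking \<open>a\<close> to \<open>b\<close> and \<open>b\<close> to
  \<open>a\<close> compose to a map fixing \<open>a\<close>, hence to the identity. So the first is
  an automorphism, and as it moves \<open>a\<close> it has no fixed point at all.\<close>

lemma deck_mob_exists: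
  assumes p: "disc_lifting (ball 0 1) p D" and D: "open D"
    and ab: "norm a < 1" "norm b < 1" "p a = p b" "a \<noteq> b"
  obtains A B where "deck p A B" "\<forall>z. norm z < 1 \<longrightarrow> mob A B z \<noteq> z"
proof -
  obtain \<psi> where \<psi>: "disc_map (ball 0 1) \<psi>" "\<And>z. norm z < 1 \<Longrightarrow> p (\<psi> z) = p z" "\<psi> a = b"
    using deck_exists[OF p D ab(1,2,3)] by blast
  obtain \<eta> where \<eta>: "disc_map (ball 0 1) \<eta>" "\<And>z. norm z < 1 \<Longrightarrow> p (\<eta> z) = p z" "\<eta> b = a"
    using deck_exists[OF p D ab(2,1) ab(3)[symmetric]] by blast
  have \<psi>1: "norm (\<psi> z) < 1" if "norm z < 1" for z using disc_map_mem[OF \<psi>(1) that] by simp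
  have \<eta>\<psi>: "disc_map (ball 0 1) (\<lambda>z. \<eta> (\<psi> z))"
    by (rule disc_map_compose[OF \<psi>(1)]) (use \<eta>(1) in \<open>auto simp: disc_map_def\<close>)
  have "\<eta> (\<psi> z) = z" if "norm z < 1" for z
    by (rule deck_fixpoint_imp_id[OF p D \<eta>\<psi> _ ab(1) _ that]) (use \<eta> \<psi> \<psi>1 in auto)
  then obtain A B where AB: "norm B < norm A" "\<And>z. norm z < 1 \<Longrightarrow> \<psi> z = mob A B z"
    using disc_automorphism_eq_mob[OF \<psi>(1) \<eta>(1)] by blast
  have "mob A B z \<noteq> z" if z: "norm z < 1" for z
  proof
    assume "mob A B z = z"
    then have "\<psi> z = z" using AB(2)[OF z] by simp
    then have "\<psi> a = a" using deck_fixpoint_imp_id[of p D \<psi> z a] p D \<psi> z ab(1) by metis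
    then show False using \<psi>(3) ab(4) by simp
  qed
  moreover have "deck p A B" unfolding deck_def using AB \<psi>(2) by metis
  ultimately show thesis using that by blast
qed

text \<open>The complement of the image in \<open>D\<close> is open as well: a round disc in
  \<open>D\<close> about an omitted point cannot meet the image, for otherwise it could be lifted
  and its centre would be a value.\<close>

lemma disc_lifting_surj:
  assumes p: "disc_lifting (ball 0 1) p D" and D: "open D" "connected D" and op: "open (p ` ball 0 1)"
  shows "p ` ball 0 1 = D"
proof -
  have sub: "p ` ball 0 1 \<subseteq> D" using disc_lifting_mem[OF p] by blast
  have "open (D - p ` ball 0 1)"
    unfolding open_contains_ball
  proof
    fix w assume w: "w \<in> D - p ` ball 0 1"
    then obtain \<rho> where \<rho>: "0 < \<rho>" "ball w \<rho> \<subseteq> D" using D open_contains_ball by blast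
    have "p a \<notin> ball w \<rho>" if a: "a \<in> ball 0 1" for a
    proof
      assume pa: "p a \<in> ball w \<rho>"
      \<comment> \<open>\<open>w + \<rho> * mob 1 c t\<close> parametrises the same round disc so
        that it starts at \<open>p a\<close>; it reaches the centre \<open>w\<close> at
        \<open>t = - c\<close>.\<close>
      define c where "c = (p a - w) / of_real \<rho>"
      have c: "norm c < norm (1::complex)"
        using pa \<rho>(1) by (simp add: c_def norm_divide dist_norm norm_minus_commute)
      have m: "norm (mob 1 c t) < 1" if "norm t < 1" for t using norm_mob_less_1[OF c that] .
      have "disc_map D (\<lambda>t. w + of_real \<rho> * mob 1 c t)"
      proof (intro disc_mapI holomorphic_intros disc_map_holomorphic[OF disc_map_mob[OF c]])
        fix t :: complex assume "norm t < 1"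
        then have "w + of_real \<rho> * mob 1 c t \<in> ball w \<rho>" using \<rho>(1) m by (simp add: dist_norm norm_mult)
        then show "w + of_real \<rho> * mob 1 c t \<in> D" using \<rho>(2) by blast
      qed
      moreover have "w + of_real \<rho> * mob 1 c 0 = p a" using \<rho>(1) by (simp add: mob_0 c_def)
      ultimately obtain \<phi> where \<phi>: "disc_map (ball 0 1) \<phi>"
        "\<And>t. norm t < 1 \<Longrightarrow> p (\<phi> t) = w + of_real \<rho> * mob 1 c t"
        using disc_lifting_lift[OF p a] by metis
      have "p (\<phi> (- c)) = w" using \<phi>(2)[of "- c"] c by (simp add: mob_def)
      then show False using w disc_map_mem[OF \<phi>(1), of "- c"] c by auto
    qed
    then show "\<exists>e>0. ball w e \<subseteq> D - p ` ball 0 1" using \<rho> by (intro exI[of _ \<rho>]) auto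
  qed
  moreover have "p 0 \<in> p ` ball 0 1" by simp
  ultimately have "D - p ` ball 0 1 = {}"
    using connectedD[OF D(2) op, of "D - p ` ball 0 1"] sub by blast
  then show ?thesis using sub by blast
qed

lemma disc_lifting_not_injective:
  assumes p: "disc_lifting (ball 0 1) p D" and D: "domain_C D" "\<not> simply_connected D"
  obtains a b where "norm a < 1" "norm b < 1" "p a = p b" "a \<noteq> b"
proof -
  have "\<not> inj_on p (ball 0 1)"
  proof
    assume inj: "inj_on p (ball 0 1)"
    have D': "open D" "connected D" using D by (auto simp: domain_C_def)
    note hol = disc_lifting_holomorphic[OF p]
    have surj: "p ` ball 0 1 = D"
      by (rule disc_lifting_surj[OF p D' open_mapping_thm3[OF hol open_ball inj]])
    obtain q where q: "q holomorphic_on D" "\<And>z. z \<in> ball 0 1 \<Longrightarrow> q (p z) = z"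
      using holomorphic_has_inverse[OF hol open_ball inj] surj by metis
    have "\<exists>f g. f holomorphic_on D \<and> g holomorphic_on ball 0 1 \<and>
       (\<forall>z\<in>D. f z \<in> ball 0 1 \<and> g (f z) = z) \<and> (\<forall>z\<in>ball 0 1. g z \<in> D \<and> f (g z) = z)"
      using q hol surj by (intro exI[of _ q] exI[of _ p]) auto
    then show False using D(2) simply_connected_eq_biholomorphic_to_disc[OF D'(1)] by blast
  qed
  then show thesis using that by (auto simp: inj_on_def)
qed

section \<open>Normalising the two coverings\<close>

lemma disc_lifting_mob:
  assumes p: "disc_lifting (ball 0 1) p D" and s: "norm s < 1"
  shows "disc_lifting (ball 0 1) (\<lambda>z. p (mob 1 s z)) D"
proof (rule disc_lifting_compose[OF p], rule disc_lifting_biholomorphic[where v = "mob 1 (- s)"])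
  have s': "norm s < norm (1::complex)" "norm (- s) < norm (1::complex)" using s by auto
  show "mob 1 s holomorphic_on ball 0 1" "mob 1 (- s) holomorphic_on ball 0 1"
    using disc_map_mob[OF s'(1)] disc_map_mob[OF s'(2)] by (auto simp: disc_map_def)
  show "mob 1 s z \<in> ball 0 1 \<and> mob 1 (- s) (mob 1 s z) = z" if "z \<in> ball 0 1" for z
    using that mob_inverse[OF s'(1), of z] norm_mob_less_1[OF s'(1), of z] by simp
  show "mob 1 (- s) z \<in> ball 0 1 \<and> mob 1 s (mob 1 (- s) z) = z" if "z \<in> ball 0 1" for z
    using that mob_inverse[OF s'(2), of z] norm_mob_less_1[OF s'(2), of z] by simp
qed simp

lemma disc_lifting_rotate:
  assumes p: "disc_lifting (ball 0 1) p D" and u: "norm u = 1"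
  shows "disc_lifting (ball 0 1) (\<lambda>z. p (u * z)) D"
proof (rule disc_lifting_compose[OF p], rule disc_lifting_biholomorphic[where v = "\<lambda>z. z / u"])
  show "(\<lambda>z. z / u) holomorphic_on ball 0 1" using u by (intro holomorphic_intros) auto
qed (use u in \<open>auto simp: norm_mult norm_divide intro!: holomorphic_intros\<close>)

text \<open>Conjugating one fixed-point-free deck transformation amounts to moving the base point of
  the covering. As all displacements above a threshold occur, two coverings can share one. The
  conditions on \<open>Re A\<close> and \<open>Im A\<close> make \<open>A / cnj A\<close> nonreal,
  so that inversion changes it.\<close>

lemma deck_displacement:
  assumes p: "disc_lifting (ball 0 1) p D" and D: "domain_C D" "\<not> simply_connected D"
  obtains \<delta>\<^sub>0 where "\<delta>\<^sub>0 < 1" "\<And>\<delta>. \<delta>\<^sub>0 < \<delta> \<Longrightarrow> \<delta> < 1 \<Longrightarrow>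
    \<exists>q A B. disc_lifting (ball 0 1) q D \<and> deck q A B \<and> norm B = \<delta> * norm A \<and> Re A \<noteq> 0 \<and> Im A \<noteq> 0"
proof -
  have op: "open D" using D by (simp add: domain_C_def)
  obtain a b where "norm a < 1" "norm b < 1" "p a = p b" "a \<noteq> b"
    using disc_lifting_not_injective[OF p D] by blast
  then obtain A B where "deck p A B" and fp: "\<forall>z. norm z < 1 \<longrightarrow> mob A B z \<noteq> z"
    using deck_mob_exists[OF p op] by blast
  then have lt: "norm B < norm A" and dk: "\<And>z. norm z < 1 \<Longrightarrow> p (mob A B z) = p z"
    by (auto simp: deck_def)
  show thesis
  proof
    have A0: "0 < norm A" using lt norm_ge_zero[of B] by linarith
    then show "norm B / norm A < 1" using lt by simp
    fix \<delta> assume \<delta>: "norm B / norm A < \<delta>" "\<delta> < 1"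
    obtain s A' B' where s: "norm s < 1" "norm B' = \<delta> * norm A'" "Re A' \<noteq> 0" "Im A' \<noteq> 0"
      "\<forall>z. norm z < 1 \<longrightarrow> mob 1 (- s) (mob A B (mob 1 s z)) = mob A' B' z"
      using mob_conjugate_displacement[OF lt _ \<delta>] fp by metis
    have s': "norm s < norm (1::complex)" "norm (- s) < norm (1::complex)" using s(1) by auto
    have "A' \<noteq> 0" using s(3) by auto
    then have lt': "norm B' < norm A'" using s(2) \<delta>(2) by simp
    have "p (mob 1 s (mob A' B' z)) = p (mob 1 s z)" if z: "norm z < 1" for z
    proof -
      have m: "norm (mob 1 s z) < 1" by (rule norm_mob_less_1[OF s'(1) z])
      have "mob 1 s (mob A' B' z) = mob A B (mob 1 s z)"
        using s(5) z mob_inverse[OF s'(2) norm_mob_less_1[OF lt m]] by simp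
      then show ?thesis using dk[OF m] by simp
    qed
    then have "deck (\<lambda>z. p (mob 1 s z)) A' B'" using lt' by (simp add: deck_def)
    then show "\<exists>q A B. disc_lifting (ball 0 1) q D \<and> deck q A B \<and> norm B = \<delta> * norm A \<and> Re A \<noteq> 0 \<and> Im A \<noteq> 0"
      using disc_lifting_mob[OF p s(1)] s(2-4) by blast
  qed
qed

lemma deck_inverse:
  assumes "deck p A B"
  shows "deck p (cnj A) (- B)"
proof -
  have lt: "norm B < norm A" and dk: "\<And>z. norm z < 1 \<Longrightarrow> p (mob A B z) = p z"
    using assms by (auto simp: deck_def)
  have lt': "norm (- B) < norm (cnj A)" using lt by simp
  have "p (mob (cnj A) (- B) z) = p z" if z: "norm z < 1" for z
    using dk[OF norm_mob_less_1[OF lt' z]] mob_inverse[OF lt' z] by simp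
  then show ?thesis using lt' by (simp add: deck_def)
qed

text \<open>Rotating the covering turns the image of 0 onto the positive axis and leaves
  \<open>A\<close> alone, hence also \<open>A / cnj A\<close>.\<close>

lemma deck_rotate:
  assumes p: "disc_lifting (ball 0 1) p D" and dk: "deck p A B" and B: "norm B = \<delta> * norm A" and \<delta>: "0 < \<delta>"
  obtains q B' where "disc_lifting (ball 0 1) q D" "deck q A B'" "B' = of_real \<delta> * cnj A"
proof -
  have lt: "norm B < norm A" and dk': "\<And>z. norm z < 1 \<Longrightarrow> p (mob A B z) = p z"
    using dk by (auto simp: deck_def)
  have A0: "A \<noteq> 0" using lt by auto
  define u where "u = B / (of_real \<delta> * cnj A)"
  have u: "norm u = 1" using A0 \<delta> B by (simp add: u_def norm_divide norm_mult)
  then have uc: "u * cnj u = 1" by (simp add: complex_norm_square[symmetric])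
  have Bu: "B = u * (of_real \<delta> * cnj A)" using A0 \<delta> by (simp add: u_def)
  define B' where "B' = of_real \<delta> * cnj A"
  have conj: "u * mob A B' z = mob A B (u * z)" for z
  proof -
    have "cnj B * (u * z) + cnj A = (u * cnj u) * (cnj B' * z) + cnj A"
      unfolding Bu B'_def by (simp add: algebra_simps)
    then have "cnj B * (u * z) + cnj A = cnj B' * z + cnj A" using uc by simp
    moreover have "A * (u * z) + B = u * (A * z + B')" unfolding Bu B'_def by (simp add: algebra_simps)
    ultimately show ?thesis unfolding mob_def by (simp only: times_divide_eq_right)
  qed
  have "norm B' = norm B" using B \<delta> by (simp add: B'_def norm_mult)
  then have "deck (\<lambda>z. p (u * z)) A B'"
    unfolding deck_def conj using lt dk' u by (auto simp: norm_mult)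
  then show thesis using that[OF disc_lifting_rotate[OF p u]] by (simp add: B'_def)
qed

text \<open>For given \<open>\<delta>\<close> only the argument of the derivative varies, and
  \<open>A / cnj A\<close> records it.\<close>

lemma deriv_mob_normalized:
  assumes "A \<noteq> 0" "0 < \<delta>" "\<delta> < 1"
  shows "deriv (mob A (of_real \<delta> * cnj A)) 0 = of_real (1 - \<delta>\<^sup>2) * (A / cnj A)"
proof -
  have "deriv (mob A (of_real \<delta> * cnj A)) 0
    = (A * cnj A - (of_real \<delta> * cnj A) * cnj (of_real \<delta> * cnj A)) / (cnj A)\<^sup>2"
    using assms by (intro DERIV_imp_deriv deriv_mob_0) (simp add: norm_mult)
  also have "\<dots> = of_real (1 - \<delta>\<^sup>2) * (A / cnj A)"
    using assms by (simp add: field_simps power2_eq_square)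
  finally show ?thesis .
qed

text \<open>A deck transformation and its inverse have conjugate invariants \<open>A / cnj A\<close>, so at least one
  of them differs from that of the second covering.\<close>

lemma common_deck_pair:
  assumes D1: "domain_C D1" "\<not> simply_connected D1" and D2: "domain_C D2" "\<not> simply_connected D2"
    and p1: "disc_lifting (ball 0 1) p1 D1" and p2: "disc_lifting (ball 0 1) p2 D2"
  obtains q1 q2 A1 B1 A2 B2 \<delta> where "disc_lifting (ball 0 1) q1 D1" "disc_lifting (ball 0 1) q2 D2"
    "deck q1 A1 B1" "deck q2 A2 B2" "mob A1 B1 0 = of_real \<delta>" "mob A2 B2 0 = of_real \<delta>"
    "deriv (mob A1 B1) 0 \<noteq> deriv (mob A2 B2) 0" "0 < \<delta>" "\<delta> < 1"
proof -
  obtain d1 where d1: "d1 < 1" "\<And>\<delta>. d1 < \<delta> \<Longrightarrow> \<delta> < 1 \<Longrightarrow>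
    \<exists>q A B. disc_lifting (ball 0 1) q D1 \<and> deck q A B \<and> norm B = \<delta> * norm A \<and> Re A \<noteq> 0 \<and> Im A \<noteq> 0"
    by (rule deck_displacement[OF p1 D1]) blast
  obtain d2 where d2: "d2 < 1" "\<And>\<delta>. d2 < \<delta> \<Longrightarrow> \<delta> < 1 \<Longrightarrow>
    \<exists>q A B. disc_lifting (ball 0 1) q D2 \<and> deck q A B \<and> norm B = \<delta> * norm A \<and> Re A \<noteq> 0 \<and> Im A \<noteq> 0"
    by (rule deck_displacement[OF p2 D2]) blast
  have "max 0 (max d1 d2) < 1" using d1 d2 by simp
  then obtain \<delta> where "max 0 (max d1 d2) < \<delta>" "\<delta> < 1" using dense by blast
  then have \<delta>: "0 < \<delta>" "\<delta> < 1" "d1 < \<delta>" "d2 < \<delta>" by auto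
  obtain q1 A1 B1 where q1: "disc_lifting (ball 0 1) q1 D1" "deck q1 A1 B1" "norm B1 = \<delta> * norm A1"
    "Re A1 \<noteq> 0" "Im A1 \<noteq> 0"
    using d1(2)[OF \<delta>(3,2)] by blast
  obtain q2 A2 B2 where q2: "disc_lifting (ball 0 1) q2 D2" "deck q2 A2 B2" "norm B2 = \<delta> * norm A2"
    using d2(2)[OF \<delta>(4,2)] by blast
  have A0: "A1 \<noteq> 0" "A2 \<noteq> 0" using q1(2) q2(2) by (auto simp: deck_def)
  have "A1 / cnj A1 \<noteq> cnj A1 / A1"
  proof
    assume "A1 / cnj A1 = cnj A1 / A1"
    then have "A1 * A1 = cnj A1 * cnj A1" using A0 by (simp add: field_simps)
    then have "Im (A1 * A1) = Im (cnj A1 * cnj A1)" by simp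
    then show False using q1(4,5) by simp
  qed
  then obtain A B where AB: "deck q1 A B" "norm B = \<delta> * norm A" "A \<noteq> 0" "A / cnj A \<noteq> A2 / cnj A2"
  proof (cases "A1 / cnj A1 = A2 / cnj A2")
    case True
    then show ?thesis
      using that[OF deck_inverse[OF q1(2)]] q1(3) A0 \<open>A1 / cnj A1 \<noteq> cnj A1 / A1\<close> by simp
  next
    case False
    then show ?thesis using that[OF q1(2,3) A0(1)] by simp
  qed
  obtain r1 C1 where r1: "disc_lifting (ball 0 1) r1 D1" "deck r1 A C1" "C1 = of_real \<delta> * cnj A"
    using deck_rotate[OF q1(1) AB(1,2) \<delta>(1)] by blast
  obtain r2 C2 where r2: "disc_lifting (ball 0 1) r2 D2" "deck r2 A2 C2" "C2 = of_real \<delta> * cnj A2"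
    using deck_rotate[OF q2 \<delta>(1)] by blast
  have "\<delta>\<^sup>2 \<noteq> 1" using \<delta> by (simp add: power2_eq_1_iff)
  then have "complex_of_real (1 - \<delta>\<^sup>2) \<noteq> 0" by (simp only: of_real_eq_0_iff)
  then have "deriv (mob A C1) 0 \<noteq> deriv (mob A2 C2) 0"
    unfolding r1(3) r2(3) deriv_mob_normalized[OF AB(3) \<delta>(1,2)] deriv_mob_normalized[OF A0(2) \<delta>(1,2)]
    using AB(4) by (simp only: mult_cancel_left simp_thms)
  moreover have "mob A C1 0 = of_real \<delta>" "mob A2 C2 0 = of_real \<delta>"
    using AB(3) A0 by (auto simp: mob_0 r1(3) r2(3))
  ultimately show thesis using that r1(1,2) r2(1,2) \<delta>(1,2) by blast
qed

section \<open>Stability of double points\<close>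

text \<open>The Schwarz-Pick inequality for \<open>h z = \<phi> z / z\<close>: it takes the value
  \<open>c\<close> at 0, so \<open>h t\<close> stays within pseudohyperbolic distance
  \<open>s\<close> of \<open>c\<close>, and such discs shrink to a point as \<open>c\<close> tends
  to 1. For \<open>c = 1\<close> the quotient is constant of modulus 1 and is treated
  separately.\<close>

lemma Schwarz_near_identity:
  assumes \<phi>: "disc_map (ball 0 1) \<phi>" "\<phi> 0 = 0" and c: "deriv \<phi> 0 = of_real c" "0 < c" "c \<le> 1"
    and s: "s < 1" and t: "norm t \<le> s"
  shows "norm (\<phi> t - t) \<le> (1 - c\<^sup>2) / (1 - s) + (1 - c)"
proof -
  note hol = disc_map_holomorphic[OF \<phi>(1)]
  have lt: "norm (\<phi> z) < 1" if "norm z < 1" for z using disc_map_mem[OF \<phi>(1) that] by simp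
  have t1: "norm t < 1" using s t by simp
  have s0: "0 \<le> s" using t norm_ge_zero[of t] by linarith
  note Schwarz = Schwarz_Lemma[OF hol \<phi>(2) lt]
  show ?thesis
  proof (cases "c = 1")
    case True
    then obtain \<alpha> where \<alpha>: "\<And>z. norm z < 1 \<Longrightarrow> \<phi> z = \<alpha> * z"
      using Schwarz(3)[of 0] c(1) by auto
    have "(\<phi> has_field_derivative \<alpha>) (at 0)"
      by (rule has_field_derivative_transform_within_open[of "\<lambda>z. \<alpha> * z" _ _ "ball 0 1"])
        (use \<alpha> in \<open>auto intro!: derivative_eq_intros\<close>)
    then have "\<alpha> = 1" using DERIV_imp_deriv[of \<phi> \<alpha> 0] c(1) True by simp
    then show ?thesis using \<alpha>[OF t1] True by simp
  next
    case False
    then have c1: "c < 1" using c by simp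
    obtain h where h: "h holomorphic_on ball 0 1" "\<And>z. norm z < 1 \<Longrightarrow> \<phi> z = z * h z" "deriv \<phi> 0 = h 0"
      using Schwarz3[OF hol \<phi>(2)] by metis
    have h1: "norm (h z) < 1" if z: "norm z < 1" for z
    proof (cases "z = 0")
      case True
      then show ?thesis using h(3)[symmetric] c c1 by simp
    next
      case False
      have "norm (\<phi> z) \<noteq> norm z"
      proof
        assume eq: "norm (\<phi> z) = norm z"
        have "\<exists>\<alpha>. (\<forall>z. norm z < 1 \<longrightarrow> \<phi> z = \<alpha> * z) \<and> norm \<alpha> = 1"
          by (rule Schwarz(3)[of 0]) (use False eq z in auto)
        then obtain \<alpha> where \<alpha>: "\<And>z. norm z < 1 \<Longrightarrow> \<phi> z = \<alpha> * z" "norm \<alpha> = 1" by blast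
        have "(\<phi> has_field_derivative \<alpha>) (at 0)"
          by (rule has_field_derivative_transform_within_open[of "\<lambda>z. \<alpha> * z" _ _ "ball 0 1"])
            (use \<alpha> in \<open>auto intro!: derivative_eq_intros\<close>)
        then have "\<alpha> = of_real c" using DERIV_imp_deriv[of \<phi> \<alpha> 0] c(1) by simp
        then show False using \<alpha>(2) c c1 by simp
      qed
      then have "norm (\<phi> z) < norm z" using Schwarz(1)[OF _ z] by simp
      then show ?thesis using False h(2)[OF z] by (simp add: norm_mult)
    qed
    have nc: "norm (of_real c :: complex) < 1" using c c1 by simp
    define u where "u z = Moebius_function 0 (of_real c) (h z)" for z
    have hd: "disc_map (ball 0 1) h" using h h1 by (auto intro!: disc_mapI)
    have ud: "disc_map (ball 0 1) u"
      unfolding u_def using Moebius_function_norm_lt_1[OF nc]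
      by (intro disc_map_compose[OF hd Moebius_function_holomorphic[OF nc]]) auto
    have u0: "u 0 = 0" using h(3) c(1) by (simp add: u_def Moebius_function_eq_zero)
    have u1: "norm (u z) < 1" if "norm z < 1" for z using disc_map_mem[OF ud that] by simp
    have ut: "norm (u t) \<le> s"
      using Schwarz_Lemma(1)[OF disc_map_holomorphic[OF ud] u0 u1 t1] t by simp
    \<comment> \<open>\<open>w\<close> is the denominator of the Moebius function. Bounding it
      through \<open>h t - c\<close> puts the same unknown on both sides, and \<open>s < 1\<close>
      allows solving for it.\<close>
    define w where "w = 1 - of_real c * h t"
    have "norm (of_real c * h t) < 1"
      using h1[OF t1] c c1 by (metis nc norm_mult norm_mult_less mult_1)
    then have w0: "w \<noteq> 0" by (auto simp: w_def)
    have "h t - of_real c = u t * w"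
      using w0 by (simp add: u_def Moebius_function_simple w_def)
    then have "norm (h t - of_real c) \<le> s * norm w"
      using ut by (simp add: norm_mult mult_right_mono)
    also have "w = of_real (1 - c\<^sup>2) - of_real c * (h t - of_real c)"
      by (simp add: w_def algebra_simps power2_eq_square)
    also have "s * norm \<dots> \<le> s * ((1 - c\<^sup>2) + c * norm (h t - of_real c))"
    proof (rule mult_left_mono[OF _ s0])
      have "0 \<le> 1 - c\<^sup>2" using c by (simp add: power_le_one)
      then have "norm (of_real (1 - c\<^sup>2) :: complex) = 1 - c\<^sup>2" by (simp only: norm_of_real abs_of_nonneg)
      then show "norm (of_real (1 - c\<^sup>2) - of_real c * (h t - of_real c)) \<le> (1 - c\<^sup>2) + c * norm (h t - of_real c)"
        using norm_triangle_ineq4[of "of_real (1 - c\<^sup>2)" "of_real c * (h t - of_real c)"] c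
        by (simp add: norm_mult)
    qed
    also have "\<dots> \<le> (1 - c\<^sup>2) + s * norm (h t - of_real c)"
    proof -
      have "s * (1 - c\<^sup>2) \<le> 1 * (1 - c\<^sup>2)" using s c by (intro mult_right_mono) (auto simp: power_le_one)
      moreover have "s * (c * norm (h t - of_real c)) \<le> s * (1 * norm (h t - of_real c))"
        using s0 c by (intro mult_left_mono mult_right_mono) auto
      ultimately show ?thesis by (simp add: distrib_left)
    qed
    finally have "norm (h t - of_real c) * (1 - s) \<le> 1 - c\<^sup>2" by (simp add: algebra_simps)
    then have hc: "norm (h t - of_real c) \<le> (1 - c\<^sup>2) / (1 - s)" using s by (simp add: pos_le_divide_eq)
    have "\<phi> t - t = t * (h t - 1)" using h(2)[OF t1] by (simp add: algebra_simps)
    then have "norm (\<phi> t - t) \<le> norm (h t - 1)" using t1 by (simp add: norm_mult mult_left_le_one_le)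
    also have "\<dots> \<le> norm (h t - of_real c) + norm (of_real c - 1 :: complex)"
      using norm_triangle_ineq[of "h t - of_real c" "of_real c - 1"] by simp
    also have "norm (of_real c - 1 :: complex) = 1 - c"
    proof -
      have "of_real c - 1 = (of_real (c - 1) :: complex)" by simp
      then show ?thesis using c by (simp only: norm_of_real)
    qed
    finally show ?thesis using hc by simp
  qed
qed

text \<open>The map \<open>(x, y) \<mapsto> (y - \<psi>\<^sub>1 x, y - \<psi>\<^sub>2 x)\<close> is a local homeomorphism at \<open>(0, \<delta>)\<close> by transversality,
  so Brouwer's theorem provides a zero of every small perturbation of it.\<close>

lemma transversal_double_point_stable:
  assumes \<psi>1: "disc_map (ball 0 1) \<psi>1" and \<psi>2: "disc_map (ball 0 1) \<psi>2"
    and \<delta>: "\<psi>1 0 = \<delta>" "\<psi>2 0 = \<delta>" "\<delta> \<noteq> 0" and tr: "deriv \<psi>1 0 \<noteq> deriv \<psi>2 0"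
  obtains \<epsilon> s where "0 < \<epsilon>" "0 < s" "s < 1" "\<forall>\<phi>1 \<phi>2. disc_map (ball 0 1) \<phi>1 \<longrightarrow> disc_map (ball 0 1) \<phi>2 \<longrightarrow>
    (\<forall>t. norm t \<le> s \<longrightarrow> norm (\<phi>1 t - t) < \<epsilon> \<and> norm (\<phi>2 t - t) < \<epsilon>) \<longrightarrow>
    (\<exists>x y. norm x < 1 \<and> norm y < 1 \<and> x \<noteq> y \<and> \<phi>1 y = \<psi>1 (\<phi>1 x) \<and> \<phi>2 y = \<psi>2 (\<phi>2 x))"
proof -
  define d where "d = norm \<delta>"
  have d: "0 < d" "d < 1" using \<delta> disc_map_mem[OF \<psi>1, of 0] by (auto simp: d_def)
  \<comment> \<open>Chosen so that points within \<open>m\<close> of 0 and within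
    \<open>2 * m\<close> of \<open>\<delta>\<close> stay apart, and the latter stay within radius
    \<open>(1 + d) / 2\<close>.\<close>
  define m where "m = min d (1 - d) / 4"
  have m: "0 < m" "m \<le> d / 4" "m \<le> (1 - d) / 4" using d by (auto simp: m_def)
  have c1: "continuous_on (ball 0 1) \<psi>1" and c2: "continuous_on (ball 0 1) \<psi>2"
    using disc_map_holomorphic[OF \<psi>1] disc_map_holomorphic[OF \<psi>2] holomorphic_on_imp_continuous_on by auto
  have "isCont \<psi>1 0" using c1 by (simp add: continuous_on_eq_continuous_at)
  then obtain \<rho> where \<rho>: "0 < \<rho>" "\<And>x. dist x 0 < \<rho> \<Longrightarrow> dist (\<psi>1 x) (\<psi>1 0) < m"
    using m(1) unfolding continuous_at_eps_delta by metis
  define \<rho>1 where "\<rho>1 = min \<rho> m"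
  have \<rho>1: "0 < \<rho>1" "\<rho>1 \<le> \<rho>" "\<rho>1 \<le> m" using \<rho> m by (auto simp: \<rho>1_def)
  have \<rho>1': "ball 0 \<rho>1 \<subseteq> ball (0::complex) 1" using \<rho>1 m d by auto
  \<comment> \<open>Subtracting the two coordinates eliminates \<open>y\<close>. What remains is
    \<open>k x\<close>, invertible near 0 because the derivatives differ.\<close>
  define k where "k x = \<psi>2 x - \<psi>1 x" for x
  have khol: "k holomorphic_on ball 0 \<rho>1"
    unfolding k_def by (intro holomorphic_intros holomorphic_on_subset[OF disc_map_holomorphic[OF \<psi>2] \<rho>1']
        holomorphic_on_subset[OF disc_map_holomorphic[OF \<psi>1] \<rho>1'])
  have "(k has_field_derivative deriv \<psi>2 0 - deriv \<psi>1 0) (at 0)"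
    unfolding k_def by (intro derivative_intros disc_map_has_derivative[OF \<psi>1] disc_map_has_derivative[OF \<psi>2])
  then have kd: "deriv k 0 \<noteq> 0" using tr DERIV_imp_deriv[of k _ 0] by fastforce
  obtain r where r: "0 < r" "ball (0::complex) r \<subseteq> ball 0 \<rho>1" "open (k ` ball 0 r)" "inj_on k (ball 0 r)"
    by (rule has_complex_derivative_locally_invertible[OF khol centre_in_ball[THEN iffD2, OF \<rho>1(1)]
          open_ball kd]) (rule that)
  obtain l where l: "l holomorphic_on k ` ball 0 r" "\<And>z. z \<in> ball 0 r \<Longrightarrow> l (k z) = z"
    by (rule holomorphic_has_inverse[OF holomorphic_on_subset[OF khol r(2)] open_ball r(4)]) (rule that)
  have "k 0 = 0" by (simp add: k_def \<delta>)
  then have "0 \<in> k ` ball 0 r" using r(1) by force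
  then obtain \<eta>0 where \<eta>0: "0 < \<eta>0" "cball 0 \<eta>0 \<subseteq> k ` ball 0 r" using r(3) open_contains_cball by blast
  define \<eta> where "\<eta> = min (\<eta>0 / 2) m"
  have \<eta>: "0 < \<eta>" "2 * \<eta> \<le> \<eta>0" "\<eta> \<le> m" using \<eta>0 m by (auto simp: \<eta>_def)
  define s where "s = (1 + d) / 2"
  have s: "0 < s" "s < 1" using d by (auto simp: s_def)
  \<comment> \<open>The perturbed points \<open>\<phi>1 x\<close> and \<open>\<phi>2 x\<close> may
    leave \<open>cball 0 s\<close>; the larger compact disc contains them and carries the uniform
    continuity.\<close>
  define s' where "s' = (1 + s) / 2"
  have s': "s < s'" "s' < 1" using s by (auto simp: s'_def)
  have sub: "cball 0 s' \<subseteq> ball (0::complex) 1" using s' by auto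
  have "uniformly_continuous_on (cball 0 s') \<psi>1" "uniformly_continuous_on (cball 0 s') \<psi>2"
    using compact_uniformly_continuous[OF continuous_on_subset[OF c1 sub]]
      compact_uniformly_continuous[OF continuous_on_subset[OF c2 sub]] by auto
  then obtain e1 e2 where e: "0 < e1" "0 < e2"
    "\<And>x y. x \<in> cball 0 s' \<Longrightarrow> y \<in> cball 0 s' \<Longrightarrow> dist y x < e1 \<Longrightarrow> dist (\<psi>1 y) (\<psi>1 x) < \<eta> / 4"
    "\<And>x y. x \<in> cball 0 s' \<Longrightarrow> y \<in> cball 0 s' \<Longrightarrow> dist y x < e2 \<Longrightarrow> dist (\<psi>2 y) (\<psi>2 x) < \<eta> / 4"
    unfolding uniformly_continuous_on_def using \<eta>(1) by (metis zero_less_divide_iff zero_less_numeral)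
  define \<epsilon> where "\<epsilon> = min (min e1 e2) (min (\<eta> / 4) (s' - s))"
  have \<epsilon>: "0 < \<epsilon>" "\<epsilon> \<le> e1" "\<epsilon> \<le> e2" "\<epsilon> \<le> \<eta> / 4" "\<epsilon> \<le> s' - s"
    using e(1,2) \<eta>(1) s'(1) unfolding \<epsilon>_def by linarith+
  show thesis
  proof (rule that[OF \<epsilon>(1) s], intro allI impI)
    fix \<phi>1 \<phi>2 :: "complex \<Rightarrow> complex"
    assume \<phi>1: "disc_map (ball 0 1) \<phi>1" and \<phi>2: "disc_map (ball 0 1) \<phi>2"
      and near: "\<forall>t. norm t \<le> s \<longrightarrow> norm (\<phi>1 t - t) < \<epsilon> \<and> norm (\<phi>2 t - t) < \<epsilon>"
    have near1: "norm (\<phi>1 t - t) < \<epsilon>" and near2: "norm (\<phi>2 t - t) < \<epsilon>" if "norm t \<le> s" for t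
      using near that by auto
    \<comment> \<open>\<open>(X u, Y u)\<close> is the explicit local inverse:
      \<open>Y u - \<psi>1 (X u) = fst u\<close> and
      \<open>Y u - \<psi>2 (X u) = snd u\<close>.\<close>
    define X where "X u = l (fst u - snd u)" for u :: "complex \<times> complex"
    define Y where "Y u = fst u + \<psi>1 (X u)" for u
    define U where "U = cball (0::complex \<times> complex) \<eta>"
    \<comment> \<open>\<open>T\<close> is the identity minus the perturbed map in the coordinates
      \<open>u\<close>, so its fixed points are the zeros sought.\<close>
    define T where "T u = (fst u - (\<phi>1 (Y u) - \<psi>1 (\<phi>1 (X u))), snd u - (\<phi>2 (Y u) - \<psi>2 (\<phi>2 (X u))))" for u
    have inK: "fst u - snd u \<in> k ` ball 0 r" "norm (fst u) \<le> \<eta>" if "u \<in> U" for u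
    proof -
      have "norm (fst u) \<le> \<eta>" "norm (snd u) \<le> \<eta>"
        using that norm_fst_le[of "fst u" "snd u"] norm_snd_le[of "snd u" "fst u"] by (auto simp: U_def)
      then have "norm (fst u - snd u) \<le> \<eta>0"
        using norm_triangle_ineq4[of "fst u" "snd u"] \<eta>(2) by linarith
      then show "fst u - snd u \<in> k ` ball 0 r" using \<eta>0(2) by auto
      show "norm (fst u) \<le> \<eta>" by fact
    qed
    have X: "norm (X u) < \<rho>1" "k (X u) = fst u - snd u" if u: "u \<in> U" for u
    proof -
      obtain x where "x \<in> ball 0 r" "fst u - snd u = k x" using inK(1)[OF u] by blast
      then show "norm (X u) < \<rho>1" "k (X u) = fst u - snd u" using l(2) r(2) by (auto simp: X_def subset_iff)
    qed
    have X1: "norm (X u) \<le> d / 4" "norm (X u) \<le> s" "norm (X u) < 1" if "u \<in> U" for u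
      using X(1)[OF that] \<rho>1 m d by (auto simp: s_def)
    have \<psi>X: "norm (\<psi>1 (X u) - \<delta>) < m" if "u \<in> U" for u
      using \<rho>(2)[of "X u"] X(1)[OF that] \<rho>1(2) \<delta>(1) by (simp add: dist_norm)
    have Yd: "norm (Y u - \<delta>) \<le> 2 * m" if "u \<in> U" for u
      using \<psi>X[OF that] inK(2)[OF that] \<eta>(3) norm_triangle_ineq[of "fst u" "\<psi>1 (X u) - \<delta>"]
      by (simp add: Y_def add_diff_eq)
    have Y1: "norm (Y u) \<le> s" "norm (Y u) < 1" "d / 2 \<le> norm (Y u)" if "u \<in> U" for u
      using Yd[OF that] m d norm_triangle_ineq2[of "Y u" \<delta>] norm_triangle_ineq2[of \<delta> "Y u"]
      by (auto simp: d_def s_def norm_minus_commute field_simps)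
    have near_cball: "x \<in> cball 0 s'" "w \<in> cball 0 s'" if "norm x \<le> s" "norm (w - x) < \<epsilon>" for x w :: complex
      using that s' \<epsilon>(5) norm_triangle_ineq[of "w - x" x] by auto
    have b1: "norm (fst (T u)) \<le> \<eta> / 2" if u: "u \<in> U" for u
    proof -
      have "dist (\<psi>1 (\<phi>1 (X u))) (\<psi>1 (X u)) < \<eta> / 4"
        using near_cball[OF X1(2)[OF u] near1[OF X1(2)[OF u]]] near1[OF X1(2)[OF u]] \<epsilon>(2)
        by (intro e(3)) (auto simp: dist_norm)
      moreover have "norm (\<phi>1 (Y u) - Y u) < \<eta> / 4" using near1[OF Y1(1)[OF u]] \<epsilon>(4) by linarith
      moreover have "fst (T u) = (\<psi>1 (\<phi>1 (X u)) - \<psi>1 (X u)) - (\<phi>1 (Y u) - Y u)"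
        by (simp add: T_def Y_def)
      ultimately show ?thesis
        using norm_triangle_ineq4[of "\<psi>1 (\<phi>1 (X u)) - \<psi>1 (X u)" "\<phi>1 (Y u) - Y u"] by (simp add: dist_norm)
    qed
    have Y2: "Y u - \<psi>2 (X u) = snd u" if "u \<in> U" for u
      using X(2)[OF that] by (simp add: Y_def k_def algebra_simps)
    have b2: "norm (snd (T u)) \<le> \<eta> / 2" if u: "u \<in> U" for u
    proof -
      have "dist (\<psi>2 (\<phi>2 (X u))) (\<psi>2 (X u)) < \<eta> / 4"
        using near_cball[OF X1(2)[OF u] near2[OF X1(2)[OF u]]] near2[OF X1(2)[OF u]] \<epsilon>(3)
        by (intro e(4)) (auto simp: dist_norm)
      moreover have "norm (\<phi>2 (Y u) - Y u) < \<eta> / 4" using near2[OF Y1(1)[OF u]] \<epsilon>(4) by linarith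
      moreover have "snd (T u) = (\<psi>2 (\<phi>2 (X u)) - \<psi>2 (X u)) - (\<phi>2 (Y u) - Y u)"
        using Y2[OF u] by (simp add: T_def algebra_simps)
      ultimately show ?thesis
        using norm_triangle_ineq4[of "\<psi>2 (\<phi>2 (X u)) - \<psi>2 (X u)" "\<phi>2 (Y u) - Y u"] by (simp add: dist_norm)
    qed
    have "T u \<in> U" if "u \<in> U" for u
      using b1[OF that] b2[OF that] norm_Pair_le[of "fst (T u)" "snd (T u)"] by (simp add: U_def)
    then have TU: "T \<in> U \<rightarrow> U" by blast
    have cX: "continuous_on U X"
      unfolding X_def
      by (rule continuous_on_compose2[OF holomorphic_on_imp_continuous_on[OF l(1)]])
        (use inK in \<open>auto intro!: continuous_intros\<close>)
    have cY: "continuous_on U Y"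
      unfolding Y_def
      by (intro continuous_intros continuous_on_compose2[OF c1 cX]) (use X1(3) in auto)
    have cd: "continuous_on (ball 0 1) \<phi>" if "disc_map (ball 0 1) \<phi>" for \<phi>
      using disc_map_holomorphic[OF that] holomorphic_on_imp_continuous_on by blast
    have \<phi>b: "norm (\<phi>1 t) < 1" "norm (\<phi>2 t) < 1" if "norm t < 1" for t
      using disc_map_mem[OF \<phi>1 that] disc_map_mem[OF \<phi>2 that] by auto
    have cX1: "continuous_on U (\<lambda>u. \<phi>1 (X u))" "continuous_on U (\<lambda>u. \<phi>2 (X u))"
      by (rule continuous_on_compose2[OF cd[OF \<phi>1] cX] continuous_on_compose2[OF cd[OF \<phi>2] cX],
          use X1(3) in auto)+
    have cT: "continuous_on U T"
      unfolding T_def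
      by (intro continuous_intros continuous_on_compose2[OF c1 cX1(1)] continuous_on_compose2[OF c2 cX1(2)]
          continuous_on_compose2[OF cd[OF \<phi>1] cY] continuous_on_compose2[OF cd[OF \<phi>2] cY])
        (use X1(3) Y1(2) \<phi>b in auto)
    obtain u where u: "u \<in> U" "T u = u"
      using brouwer_ball[OF \<eta>(1), of 0 T] cT TU unfolding U_def by blast
    have "\<phi>1 (Y u) = \<psi>1 (\<phi>1 (X u))" "\<phi>2 (Y u) = \<psi>2 (\<phi>2 (X u))"
      using u(2) by (auto simp: T_def prod_eq_iff)
    moreover have "X u \<noteq> Y u" using X1(1)[OF u(1)] Y1(3)[OF u(1)] d by auto
    ultimately show "\<exists>x y. norm x < 1 \<and> norm y < 1 \<and> x \<noteq> y \<and> \<phi>1 y = \<psi>1 (\<phi>1 x) \<and> \<phi>2 y = \<psi>2 (\<phi>2 x)"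
      using X1(3)[OF u(1)] Y1(2)[OF u(1)] by blast
  qed
qed

section \<open>Failure of equality when both factors are covered by the disc\<close>

lemma near_identity_threshold:
  assumes "0 < \<epsilon>" "s < (1::real)"
  obtains c0 where "0 < c0" "c0 < 1" "\<And>c. c0 < c \<Longrightarrow> c \<le> 1 \<Longrightarrow> (1 - c\<^sup>2) / (1 - s) + (1 - c) < \<epsilon>"
proof -
  have "((\<lambda>c::real. (1 - c\<^sup>2) / (1 - s) + (1 - c)) \<longlongrightarrow> (1 - 1\<^sup>2) / (1 - s) + (1 - 1)) (at 1)"
    using assms by (intro tendsto_intros) auto
  then have "isCont (\<lambda>c::real. (1 - c\<^sup>2) / (1 - s) + (1 - c)) 1" by (simp add: isCont_def)
  then obtain d where d: "0 < d" "\<And>c. dist c 1 < d \<Longrightarrow>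
      dist ((1 - c\<^sup>2) / (1 - s) + (1 - c)) ((1 - 1\<^sup>2) / (1 - s) + (1 - 1)) < \<epsilon>"
    using assms(1) unfolding continuous_at_eps_delta by metis
  show thesis
  proof
    show "0 < max (1/2) (1 - d)" "max (1/2) (1 - d) < 1" using d(1) by auto
    fix c :: real assume c: "max (1/2) (1 - d) < c" "c \<le> 1"
    then have "dist c 1 < d" by (simp add: dist_real_def)
    from d(2)[OF this] show "(1 - c\<^sup>2) / (1 - s) + (1 - c) < \<epsilon>" by (simp add: dist_real_def)
  qed
qed

lemma omits_two_points:
  assumes D: "domain_C D" "\<not> simply_connected D" "\<not> biholomorphic D (- {0})"
  obtains w1 w2 where "w1 \<noteq> w2" "w1 \<notin> D" "w2 \<notin> D"
proof -
  have "D \<noteq> UNIV" using D(2) by (auto simp: convex_imp_simply_connected)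
  then obtain w1 where w1: "w1 \<notin> D" by blast
  have "D \<noteq> - {w1}"
  proof
    assume "D = - {w1}"
    then have "biholomorphic D (- {0})"
      unfolding biholomorphic_def
      by (intro exI[of _ "\<lambda>z. z - w1"] exI[of _ "\<lambda>z. z + w1"]) (auto intro!: holomorphic_intros)
    then show False using D(3) by simp
  qed
  then show thesis using w1 that by blast
qed

text \<open>The pair of coverings shows that the Kobayashi metric is at most 1 in the direction of
  its own derivative. Equality would give an injective disc with multiplier below
  \<open>1 / c0\<close>; its lifts are so close to the identity that the double point of the
  coverings persists in it.\<close>

lemma hahn_neq_kobayashi:
  assumes D1: "domain_C D1" "\<not> simply_connected D1" "\<not> biholomorphic D1 (- {0})"
    and D2: "domain_C D2" "\<not> simply_connected D2" "\<not> biholomorphic D2 (- {0})"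
  shows "\<not> hahn_eq_kobayashi (D1 \<times> D2)"
proof
  assume eq: "hahn_eq_kobayashi (D1 \<times> D2)"
  have op: "open D1" "open D2" using D1 D2 by (auto simp: domain_C_def)
  have cover: "\<exists>p. disc_lifting (ball 0 1) p D"
    if D: "domain_C D" "\<not> simply_connected D" "\<not> biholomorphic D (- {0})" for D
  proof -
    obtain w1 w2 where w: "w1 \<noteq> w2" "w1 \<notin> D" "w2 \<notin> D" using omits_two_points[OF D] .
    obtain z where "open D" "z \<in> D" using D(1) by (auto simp: domain_C_def)
    from disc_lifting_exists[OF this w] show ?thesis by blast
  qed
  obtain p1 p2 where "disc_lifting (ball 0 1) p1 D1" "disc_lifting (ball 0 1) p2 D2"
    using cover[OF D1] cover[OF D2] by blast
  from common_deck_pair[OF D1(1,2) D2(1,2) this]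
  obtain q1 q2 A1 B1 A2 B2 \<delta> where q: "disc_lifting (ball 0 1) q1 D1" "disc_lifting (ball 0 1) q2 D2"
    and dk: "deck q1 A1 B1" "deck q2 A2 B2" and m: "mob A1 B1 0 = of_real \<delta>" "mob A2 B2 0 = of_real \<delta>"
    and tr: "deriv (mob A1 B1) 0 \<noteq> deriv (mob A2 B2) 0" and \<delta>: "0 < \<delta>" "\<delta> < 1" .
  have lt: "norm B1 < norm A1" "norm B2 < norm A2" using dk by (auto simp: deck_def)
  have "complex_of_real \<delta> \<noteq> 0" using \<delta> by simp
  from transversal_double_point_stable[OF disc_map_mob[OF lt(1)] disc_map_mob[OF lt(2)] m this tr]
  obtain \<epsilon> s where \<epsilon>: "0 < \<epsilon>" "0 < s" "s < 1"
    and stable: "\<forall>\<phi>1 \<phi>2. disc_map (ball 0 1) \<phi>1 \<longrightarrow> disc_map (ball 0 1) \<phi>2 \<longrightarrow>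
    (\<forall>t. norm t \<le> s \<longrightarrow> norm (\<phi>1 t - t) < \<epsilon> \<and> norm (\<phi>2 t - t) < \<epsilon>) \<longrightarrow>
    (\<exists>x y. norm x < 1 \<and> norm y < 1 \<and> x \<noteq> y \<and> \<phi>1 y = mob A1 B1 (\<phi>1 x) \<and> \<phi>2 y = mob A2 B2 (\<phi>2 x))" .
  obtain c0 where c0: "0 < c0" "c0 < 1" "\<And>c. c0 < c \<Longrightarrow> c \<le> 1 \<Longrightarrow> (1 - c\<^sup>2) / (1 - s) + (1 - c) < \<epsilon>"
    by (rule near_identity_threshold[OF \<epsilon>(1,3)]) (rule that, auto)
  define z where "z = (q1 0, q2 0)"
  define X where "X = (deriv q1 0, deriv q2 0)"
  have nz: "deriv q1 0 \<noteq> 0" "deriv q2 0 \<noteq> 0"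
    using disc_lifting_deriv_nonzero[OF q(1) op(1)] disc_lifting_deriv_nonzero[OF q(2) op(2)] by auto
  have zD: "z \<in> D1 \<times> D2" using disc_lifting_mem[OF q(1)] disc_lifting_mem[OF q(2)] by (auto simp: z_def)
  have "(\<lambda>t. (q1 t, q2 t)) \<in> hol_discs (D1 \<times> D2)"
    using disc_lifting_holomorphic[OF q(1)] disc_lifting_holomorphic[OF q(2)]
      disc_lifting_mem[OF q(1)] disc_lifting_mem[OF q(2)] by (auto simp: hol_discs_def)
  then have "kobayashi (D1 \<times> D2) z X \<le> cmod 1"
    unfolding kobayashi_def
    by (intro cInf_lower[OF _ bdd_below_cmod] CollectI exI[of _ 1] exI[of _ "\<lambda>t. (q1 t, q2 t)"])
      (auto simp: disc_deriv0_def z_def X_def)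
  then have "hahn (D1 \<times> D2) z X \<le> 1" using eq zD unfolding hahn_eq_kobayashi_def by (metis norm_one)
  also have "1 < 1 / c0" using c0 by simp
  finally have "hahn (D1 \<times> D2) z X < 1 / c0" .
  then obtain \<alpha> f where \<alpha>: "cmod \<alpha> < 1 / c0" and f: "f \<in> hol_discs (D1 \<times> D2)" "inj_on f (ball 0 1)" "f 0 = z"
    and fX: "(\<alpha> * fst (disc_deriv0 f), \<alpha> * snd (disc_deriv0 f)) = X"
    using hahn_lessD[OF open_Times[OF op] zD] by blast
  define f1 where "f1 t = fst (f t)" for t
  define f2 where "f2 t = snd (f t)" for t
  have f12: "disc_map D1 f1" "disc_map D2 f2"
    using f(1) unfolding hol_discs_def f1_def f2_def disc_map_def by auto
  have f0: "f1 0 = q1 0" "f2 0 = q2 0" using f(3) by (auto simp: f1_def f2_def z_def)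
  have fd: "\<alpha> * deriv f1 0 = deriv q1 0" "\<alpha> * deriv f2 0 = deriv q2 0"
    using fX unfolding disc_deriv0_def X_def f1_def f2_def by auto
  have \<alpha>0: "\<alpha> \<noteq> 0" using fd nz by auto
  have lift: "\<exists>\<phi>. disc_map (ball 0 1) \<phi> \<and> (\<forall>t. norm t < 1 \<longrightarrow> p (\<phi> t) = g (\<alpha> / of_real (norm \<alpha>) * t)) \<and>
      (\<forall>t. norm t \<le> s \<longrightarrow> norm (\<phi> t - t) < \<epsilon>)"
    if p: "disc_lifting (ball 0 1) p D" "deriv p 0 \<noteq> 0" and g: "disc_map D g" "g 0 = p 0" "\<alpha> * deriv g 0 = deriv p 0"
    for p D g
  proof -
    \<comment> \<open>This rotation makes the derivative of the lift equal to
      \<open>1 / norm \<alpha>\<close>, a positive number, at most 1 by the Schwarz lemma. It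
      depends on \<open>\<alpha>\<close> only, so both components are rotated alike and a common
      coincidence of the lifts is a double point of \<open>f\<close>.\<close>
    define u where "u = \<alpha> / of_real (norm \<alpha>)"
    have u: "norm u = 1" using \<alpha>0 by (simp add: u_def norm_divide)
    have gu: "disc_map D (\<lambda>t. g (u * t))" using disc_map_scale[OF g(1)] u by simp
    obtain \<phi> where \<phi>: "disc_map (ball 0 1) \<phi>" "\<phi> 0 = 0" "\<And>t. norm t < 1 \<Longrightarrow> p (\<phi> t) = g (u * t)"
      using disc_lifting_lift[OF p(1) _ gu, of 0] g(2) by auto
    have "(p has_field_derivative deriv p 0) (at (\<phi> 0))"
      using holomorphic_derivI[OF disc_lifting_holomorphic[OF p(1)] open_ball, of 0] \<phi>(2) by simp
    then have "((\<lambda>t. p (\<phi> t)) has_field_derivative deriv p 0 * deriv \<phi> 0) (at 0)"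
      using disc_map_has_derivative[OF \<phi>(1)] DERIV_chain2 by blast
    then have "((\<lambda>t. g (u * t)) has_field_derivative deriv p 0 * deriv \<phi> 0) (at 0)"
      by (rule has_field_derivative_transform_within_open[of _ _ _ "ball 0 1"]) (use \<phi>(3) in auto)
    then have "deriv p 0 * deriv \<phi> 0 = u * deriv g 0"
      using deriv_scale[OF g(1), of u] DERIV_unique by blast
    also have "deriv g 0 = deriv p 0 / \<alpha>" using g(3) \<alpha>0 by (simp add: field_simps)
    finally have "deriv p 0 * deriv \<phi> 0 = deriv p 0 * (u / \<alpha>)" by simp
    then have "deriv \<phi> 0 = u / \<alpha>" using p(2) by (simp only: mult_cancel_left) simp
    then have d\<phi>: "deriv \<phi> 0 = of_real (1 / norm \<alpha>)" using \<alpha>0 by (simp add: u_def)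
    have "norm (deriv \<phi> 0) \<le> 1"
      using Schwarz_Lemma(2)[OF disc_map_holomorphic[OF \<phi>(1)] \<phi>(2), of 0] disc_map_mem[OF \<phi>(1)] by simp
    then have le: "1 / norm \<alpha> \<le> 1" unfolding d\<phi> by (simp add: norm_divide)
    have gt: "c0 < 1 / norm \<alpha>" using \<alpha> c0(1) \<alpha>0 by (simp add: field_simps)
    have "norm (\<phi> t - t) < \<epsilon>" if "norm t \<le> s" for t
      using Schwarz_near_identity[OF \<phi>(1,2) d\<phi> _ le \<epsilon>(3) that] c0(3)[OF gt le] c0(1) gt by linarith
    then show ?thesis using \<phi> unfolding u_def by blast
  qed
  obtain \<phi>1 where \<phi>1: "disc_map (ball 0 1) \<phi>1" "\<And>t. norm t < 1 \<Longrightarrow> q1 (\<phi>1 t) = f1 (\<alpha> / of_real (norm \<alpha>) * t)"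
    "\<And>t. norm t \<le> s \<Longrightarrow> norm (\<phi>1 t - t) < \<epsilon>"
    using lift[OF q(1) nz(1) f12(1) f0(1) fd(1)] by blast
  obtain \<phi>2 where \<phi>2: "disc_map (ball 0 1) \<phi>2" "\<And>t. norm t < 1 \<Longrightarrow> q2 (\<phi>2 t) = f2 (\<alpha> / of_real (norm \<alpha>) * t)"
    "\<And>t. norm t \<le> s \<Longrightarrow> norm (\<phi>2 t - t) < \<epsilon>"
    using lift[OF q(2) nz(2) f12(2) f0(2) fd(2)] by blast
  obtain x y where xy: "norm x < 1" "norm y < 1" "x \<noteq> y" "\<phi>1 y = mob A1 B1 (\<phi>1 x)" "\<phi>2 y = mob A2 B2 (\<phi>2 x)"
    using stable \<phi>1(1,3) \<phi>2(1,3) by blast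
  have "q1 (\<phi>1 y) = q1 (\<phi>1 x)" using dk(1) xy(4) disc_map_mem[OF \<phi>1(1) xy(1)] by (simp add: deck_def)
  moreover have "q2 (\<phi>2 y) = q2 (\<phi>2 x)" using dk(2) xy(5) disc_map_mem[OF \<phi>2(1) xy(1)] by (simp add: deck_def)
  ultimately have "f (\<alpha> / of_real (norm \<alpha>) * y) = f (\<alpha> / of_real (norm \<alpha>) * x)"
    using \<phi>1(2)[OF xy(1)] \<phi>1(2)[OF xy(2)] \<phi>2(2)[OF xy(1)] \<phi>2(2)[OF xy(2)]
    by (simp add: f1_def f2_def prod_eq_iff)
  then have "\<alpha> / of_real (norm \<alpha>) * y = \<alpha> / of_real (norm \<alpha>) * x"
    using xy(1,2) \<alpha>0 by (intro inj_onD[OF f(2)]) (auto simp: norm_mult norm_divide)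
  then show False using xy(3) \<alpha>0 by simp
qed

theorem theorem1:
  fixes D1 D2 :: "complex set"
  assumes "domain_C D1" and "domain_C D2"
  shows "(simply_connected D1 \<or> simply_connected D2 \<longrightarrow> hahn_eq_kobayashi (D1 \<times> D2))
    \<and> (biholomorphic D1 (- {0}) \<or> biholomorphic D2 (- {0}) \<longrightarrow> hahn_eq_kobayashi (D1 \<times> D2))
    \<and> (\<not> simply_connected D1 \<and> \<not> simply_connected D2 \<and>
        \<not> biholomorphic D1 (- {0}) \<and> \<not> biholomorphic D2 (- {0})
        \<longrightarrow> \<not> hahn_eq_kobayashi (D1 \<times> D2))
    \<and> (hahn_eq_kobayashi (D1 \<times> D2) \<longleftrightarrow>
        simply_connected D1 \<or> simply_connected D2 \<or>
        biholomorphic D1 (- {0}) \<or> biholomorphic D2 (- {0}))"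
  using hahn_eq_kobayashi_simply_connected[OF assms] hahn_eq_kobayashi_punctured_plane[OF assms]
    hahn_neq_kobayashi[OF assms(1) _ _ assms(2)] by blast

end
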